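(* Let $q$ be an odd prime power. (a) If $q\equiv 3\pmod 4$, then $\Omega(n,q)=\emptyset$ for all $n\equiv 2\pmod 4$ and $\tilde\Omega(n+1,q)=\emptyset$ for all $n\equiv 1\pmod 4$. (b) If $q\equiv 3\pmod 4$ and $n=n(q)$ satisfies $n\to\infty$ and $n/q^{1/4}\to 0$ as $q\to\infty$, then $|\Omega(n,q)|=(1+o(1))2^{2-n}\binom{q}{n}$ when $n\equiv 0\pmod 4$, and $|\tilde\Omega(n+1,q)|=(1+o(1))2^{1-n}\binom{q}{n}$ when $n\equiv 3\pmod 4$. (c) If $q\equiv 1\pmod 4$ and $n=n(q)$ satisfies $n\to\infty$ and $n/q^{1/4}\to 0$ as $q\to\infty$, then $|\Omega(n,q)|=(1+o(1))2^{2-n}\binom{q}{n}$ when $n$ is even, and $|\tilde\Omega(n+1,q)|=(1+o(1))2^{1-n}\binom{q}{n}$ when $n$ is odd. Here $o(1)\to0$ as $q\to\infty$.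
   Context: Let $\eta$ be the quadratic character of $\mathbb{F}_q$ ($1$ on nonzero squares, $-1$ on nonsquares). For $\mathcal{S}=\{\alpha_1,\dots,\alpha_n\}\subseteq\mathbb{F}_q$, $\Delta_{\mathcal{S}}(\alpha_i)=\prod_{j\neq i}(\alpha_i-\alpha_j)$. For even $n$, $\Omega(n,q)$ is the set of all $n$-element subsets $\mathcal{S}\subseteq\mathbb{F}_q$ such that the values $\eta(\Delta_{\mathcal{S}}(\alpha_i))$, $1\le i\le n$, are all equal (equivalently, some generalized Reed–Solomon code $GRS_{n/2}(\boldsymbol\alpha,\boldsymbol v)$, $\boldsymbol v\in(\mathbb{F}_q^* )^n$, is self-dual). For odd $n$, $\tilde\Omega(n+1,q)$ is the set of all $n$-element subsets $\mathcal{S}\subseteq\mathbb{F}_q$ with $\eta(-\Delta_{\mathcal{S}}(\alpha_i))=1$ for all $i$ (equivalently, some extended GRS code $GRS_{(n+1)/2}(\boldsymbol\alpha,\boldsymbol v,\infty)$ is self-dual). *)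

theory Defs
  imports
    "HOL-Algebra.Ring"
    "HOL-Number_Theory.Cong"
    "HOL-Number_Theory.Prime_Powers"
    "HOL-Library.Landau_Symbols"
begin

definition quad_char :: "('a, 'b) ring_scheme \<Rightarrow> 'a \<Rightarrow> int" where
  "quad_char R x =
     (if x = \<zero>\<^bsub>R\<^esub> then 0
      else if \<exists>y\<in>carrier R. x = y \<otimes>\<^bsub>R\<^esub> y then 1
      else - 1)"

definition Delta :: "('a, 'b) ring_scheme \<Rightarrow> 'a set \<Rightarrow> 'a \<Rightarrow> 'a" where
  "Delta R S a = (\<Otimes>\<^bsub>R\<^esub>b\<in>S - {a}. a \<ominus>\<^bsub>R\<^esub> b)"

(* Omega F_q n is the set written Omega(n,q); it is meant for even n. *)
definition Omega :: "('a, 'b) ring_scheme \<Rightarrow> nat \<Rightarrow> 'a set set" where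
  "Omega R n =
     {S. S \<subseteq> carrier R \<and> finite S \<and> card S = n \<and>
         (\<forall>a\<in>S. \<forall>b\<in>S. quad_char R (Delta R S a) = quad_char R (Delta R S b))}"

(* The index m of the extended family is the code length, one more than the size
   of the evaluation set; it is meant for even m. *)
definition Omega_tilde :: "('a, 'b) ring_scheme \<Rightarrow> nat \<Rightarrow> 'a set set" where
  "Omega_tilde R m =
     {S. S \<subseteq> carrier R \<and> finite S \<and> card S + 1 = m \<and>
         (\<forall>a\<in>S. quad_char R (\<ominus>\<^bsub>R\<^esub> Delta R S a) = 1)}"

definition odd_prime_power :: "nat \<Rightarrow> bool" where
  "odd_prime_power q \<longleftrightarrow> primepow q \<and> odd q"

(* The filter "q tends to infinity along the odd prime powers q satisfying P". *)
definition q_at_top :: "(nat \<Rightarrow> bool) \<Rightarrow> nat filter" where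
  "q_at_top P = inf at_top (principal {q. odd_prime_power q \<and> P q})"

end

(*
  Let eta be the quadratic character and eps = eta(-1). The indicator that all
  eta(Delta_S(a)), a in S, equal sigma is prod_(a in S) (1 + sigma eta(Delta_S(a))) / 2.
  Expanding it over T <= S, the pairs inside T contribute powers of eps, and there remains the
  bipartite sum A(m,t) of prod eta(u - x) over u in T, x in S - T, with t = |T|, m = |S - T|.
  The terms t = 0 and t = n give the main term 2 binom(q,n), or cancel in the cases of part (a).

  The other terms are bounded without Weil's theorem. Write A(t,m) as a sum over t-sets T of the
  elementary symmetric functions e_m of the values of chi_T = eta o f_T, where f_T is monic with
  root set T; up to sign A is symmetric, so t <= m may be assumed. For t = 1, sum eta = 0 suffices.
  For t >= 2 put k = t div 2: averaging over subsets and over bipartitions reduces e_m to products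
  e_k(H) e_k(H') with H, H' disjoint. Now enlarge the family of the f_T to all monic polynomials of
  degree t: their values at 2k <= t distinct points are independent and uniform, so the second
  moment of e_k(H) is at most q^t binom(q,k). The loss of t! in the enlargement is affordable
  because n = o(q^(1/4)): the total relative error is O(n^4 / q).
*)
theory Submission
  imports Defs "HOL-Algebra.Multiplicative_Group"
begin

section \<open>Elementary symmetric functions\<close>

definition subsets_of_card :: "'a set \<Rightarrow> nat \<Rightarrow> 'a set set" where
  "subsets_of_card G k = {A. A \<subseteq> G \<and> card A = k}"

definition esym :: "('a \<Rightarrow> int) \<Rightarrow> nat \<Rightarrow> 'a set \<Rightarrow> int" where
  "esym w k G = (\<Sum>A\<in>subsets_of_card G k. prod w A)"

lemma subsets_of_cardD:
  assumes "A \<in> subsets_of_card G k"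
  shows "A \<subseteq> G" "card A = k" "finite G \<Longrightarrow> finite A"
  using assms by (auto simp: subsets_of_card_def intro: finite_subset)

lemma finite_subsets_of_card [simp]: "finite G \<Longrightarrow> finite (subsets_of_card G k)"
  by (simp add: subsets_of_card_def)

lemma card_subsets_of_card: "finite G \<Longrightarrow> card (subsets_of_card G k) = card G choose k"
  by (simp add: subsets_of_card_def n_subsets)

lemma subsets_of_card_0: "finite G \<Longrightarrow> subsets_of_card G 0 = {{}}"
  by (auto simp: subsets_of_card_def dest: finite_subset)

lemma subsets_of_card_1: "subsets_of_card G 1 = (\<lambda>x. {x}) ` G"
  by (auto simp: subsets_of_card_def card_1_singleton_iff)

lemma subsets_of_card_empty: "finite G \<Longrightarrow> card G < k \<Longrightarrow> subsets_of_card G k = {}"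
  by (auto simp: subsets_of_card_def dest: card_mono)

text \<open>A nested pair B, U corresponds to the disjoint pair W = U - B and B, since U is
  recovered as the union of W and B. The lemma serves twice: to lower the order of a symmetric
  function, and to turn the double sum over S and T into a sum over root sets and evaluation
  sets.\<close>

lemma sum_pairs_subset_eq_disjoint:
  fixes h :: "'a set \<Rightarrow> 'a set \<Rightarrow> 'b :: comm_monoid_add"
  assumes G: "finite G" and l: "l \<le> m"
  shows "(\<Sum>U\<in>subsets_of_card G m. \<Sum>B\<in>subsets_of_card U l. h (U - B) B) =
         (\<Sum>W\<in>subsets_of_card G (m - l). \<Sum>B\<in>subsets_of_card (G - W) l. h W B)"
proof -
  have "(\<Sum>U\<in>subsets_of_card G m. \<Sum>B\<in>subsets_of_card U l. h (U - B) B) =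
        (\<Sum>(U, B)\<in>Sigma (subsets_of_card G m) (\<lambda>U. subsets_of_card U l). h (U - B) B)"
    using G by (intro sum.Sigma) (auto dest: subsets_of_cardD)
  also have "\<dots> = (\<Sum>(W, B)\<in>Sigma (subsets_of_card G (m - l)) (\<lambda>W. subsets_of_card (G - W) l). h W B)"
  proof (rule sum.reindex_bij_witness[of _ "\<lambda>(W, B). (W \<union> B, B)" "\<lambda>(U, B). (U - B, B)"], goal_cases)
    case (2 a)
    then show ?case
      using G by (auto simp: subsets_of_card_def card_Diff_subset finite_subset)
  next
    case (4 b)
    obtain W B where b: "b = (W, B)" by force
    have "card (W \<union> B) = card W + card B"
      using 4 G unfolding b by (intro card_Un_disjoint) (auto simp: subsets_of_card_def finite_subset)
    then show ?case
      using 4 l by (auto simp: b subsets_of_card_def)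
  qed (auto simp: subsets_of_card_def)
  also have "\<dots> = (\<Sum>W\<in>subsets_of_card G (m - l). \<Sum>B\<in>subsets_of_card (G - W) l. h W B)"
    using G by (intro sum.Sigma[symmetric]) auto
  finally show ?thesis .
qed

text \<open>Every m-set splits into a set W and a disjoint l-set in \<open>m choose l\<close> ways,
  and the product of weights factors accordingly. This lowers the order from m to l at the price of
  removing W from the ground set.\<close>

lemma esym_expand:
  assumes G: "finite G" and l: "l \<le> m"
  shows "int (m choose l) * esym w m G =
         (\<Sum>W\<in>subsets_of_card G (m - l). prod w W * esym w l (G - W))"
proof -
  have "(\<Sum>U\<in>subsets_of_card G m. \<Sum>B\<in>subsets_of_card U l. prod w (U - B) * prod w B) =
        (\<Sum>U\<in>subsets_of_card G m. int (m choose l) * prod w U)"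
  proof (rule sum.cong[OF refl])
    fix U assume U: "U \<in> subsets_of_card G m"
    have "finite U" using subsets_of_cardD(3)[OF U G] .
    have "(\<Sum>B\<in>subsets_of_card U l. prod w (U - B) * prod w B) = (\<Sum>B\<in>subsets_of_card U l. prod w U)"
      using \<open>finite U\<close> by (intro sum.cong) (auto dest: subsets_of_cardD(1) simp: prod.subset_diff)
    then show "(\<Sum>B\<in>subsets_of_card U l. prod w (U - B) * prod w B) = int (m choose l) * prod w U"
      using \<open>finite U\<close> subsets_of_cardD(2)[OF U] by (simp add: card_subsets_of_card)
  qed
  then show ?thesis
    using sum_pairs_subset_eq_disjoint[OF G l, of "\<lambda>W B. prod w W * prod w B"]
    by (simp add: esym_def sum_distrib_left)
qed

lemma card_subsets_between:
  assumes G: "finite G" and "A \<subseteq> G" "B \<subseteq> G" "A \<inter> B = {}"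
  shows "card {H. A \<subseteq> H \<and> H \<subseteq> G - B} = 2 ^ (card G - card A - card B)"
proof -
  have "bij_betw (\<lambda>K. K \<union> A) (Pow (G - A - B)) {H. A \<subseteq> H \<and> H \<subseteq> G - B}"
    by (rule bij_betw_byWitness[of _ "\<lambda>H. H - A"]) (use assms in auto)
  then have "card {H. A \<subseteq> H \<and> H \<subseteq> G - B} = card (Pow (G - A - B))"
    by (simp add: bij_betw_same_card)
  also have "\<dots> = 2 ^ card (G - A - B)"
    using G by (simp add: card_Pow)
  also have "card (G - A - B) = card G - card A - card B"
    using assms by (subst card_Diff_subset) (auto simp: card_Diff_subset finite_subset)
  finally show ?thesis .
qed

text \<open>After expansion, a pair of k-sets A, B is counted once for each H containing A and
  avoiding B: \<open>2 ^ (card G - 2 * k)\<close> times if the two are disjoint, never otherwise.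
  The disjoint pairs are then collected by \<open>esym_expand\<close> with l = k and m = 2k.\<close>

lemma sum_esym_bipartition:
  assumes G: "finite G"
  shows "(\<Sum>H\<in>Pow G. esym w k H * esym w k (G - H)) =
         2 ^ (card G - 2 * k) * (int (2 * k choose k) * esym w (2 * k) G)"
proof -
  let ?S = "subsets_of_card G k"
  have "esym w k H * esym w k (G - H) =
        (\<Sum>A\<in>?S. \<Sum>B\<in>?S. if A \<subseteq> H \<and> H \<subseteq> G - B then prod w A * prod w B else 0)"
    if "H \<subseteq> G" for H
  proof -
    have H: "subsets_of_card H k = {A \<in> ?S. A \<subseteq> H}" "subsets_of_card (G - H) k = {B \<in> ?S. H \<subseteq> G - B}"
      using that by (auto simp: subsets_of_card_def)
    have "esym w k H * esym w k (G - H) =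
        (\<Sum>A\<in>?S. if A \<subseteq> H then prod w A else 0) * (\<Sum>B\<in>?S. if H \<subseteq> G - B then prod w B else 0)"
      unfolding esym_def H using G by (simp add: sum.inter_filter)
    also have "\<dots> = (\<Sum>A\<in>?S. \<Sum>B\<in>?S. (if A \<subseteq> H then prod w A else 0) * (if H \<subseteq> G - B then prod w B else 0))"
      by (rule sum_product)
    also have "\<dots> = (\<Sum>A\<in>?S. \<Sum>B\<in>?S. if A \<subseteq> H \<and> H \<subseteq> G - B then prod w A * prod w B else 0)"
      by (intro sum.cong refl) auto
    finally show ?thesis .
  qed
  then have "(\<Sum>H\<in>Pow G. esym w k H * esym w k (G - H)) =
        (\<Sum>H\<in>Pow G. \<Sum>A\<in>?S. \<Sum>B\<in>?S. if A \<subseteq> H \<and> H \<subseteq> G - B then prod w A * prod w B else 0)"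
    by simp
  also have "\<dots> = (\<Sum>A\<in>?S. \<Sum>H\<in>Pow G. \<Sum>B\<in>?S. if A \<subseteq> H \<and> H \<subseteq> G - B then prod w A * prod w B else 0)"
    by (rule sum.swap)
  also have "\<dots> = (\<Sum>A\<in>?S. \<Sum>B\<in>?S. \<Sum>H\<in>Pow G. if A \<subseteq> H \<and> H \<subseteq> G - B then prod w A * prod w B else 0)"
    by (intro sum.cong refl sum.swap)
  also have "\<dots> = (\<Sum>A\<in>?S. \<Sum>B\<in>?S. if A \<inter> B = {} then 2 ^ (card G - 2 * k) * (prod w A * prod w B) else 0)"
  proof (intro sum.cong refl)
    fix A B assume AB: "A \<in> ?S" "B \<in> ?S"
    have "(\<Sum>H\<in>Pow G. if A \<subseteq> H \<and> H \<subseteq> G - B then prod w A * prod w B else 0) =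
          (\<Sum>H\<in>{H \<in> Pow G. A \<subseteq> H \<and> H \<subseteq> G - B}. prod w A * prod w B)"
      using G by (subst sum.inter_filter) auto
    also have "{H \<in> Pow G. A \<subseteq> H \<and> H \<subseteq> G - B} = {H. A \<subseteq> H \<and> H \<subseteq> G - B}" by auto
    finally have *: "(\<Sum>H\<in>Pow G. if A \<subseteq> H \<and> H \<subseteq> G - B then prod w A * prod w B else 0) =
          int (card {H. A \<subseteq> H \<and> H \<subseteq> G - B}) * (prod w A * prod w B)" by simp
    show "(\<Sum>H\<in>Pow G. if A \<subseteq> H \<and> H \<subseteq> G - B then prod w A * prod w B else 0) =
          (if A \<inter> B = {} then 2 ^ (card G - 2 * k) * (prod w A * prod w B) else 0)"
    proof (cases "A \<inter> B = {}")
      case True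
      then show ?thesis
        unfolding * using AB card_subsets_between[OF G, of A B]
        by (simp add: subsets_of_card_def mult_2)
    next
      case False
      then have "{H. A \<subseteq> H \<and> H \<subseteq> G - B} = {}" by auto
      then have "card {H. A \<subseteq> H \<and> H \<subseteq> G - B} = 0" by (simp only: card.empty)
      with False show ?thesis unfolding * by simp
    qed
  qed
  also have "\<dots> = (\<Sum>A\<in>?S. \<Sum>B\<in>subsets_of_card (G - A) k. 2 ^ (card G - 2 * k) * (prod w A * prod w B))"
  proof (rule sum.cong[OF refl])
    fix A
    have "subsets_of_card (G - A) k = {B \<in> ?S. A \<inter> B = {}}"
      by (auto simp: subsets_of_card_def)
    then show "(\<Sum>B\<in>?S. if A \<inter> B = {} then 2 ^ (card G - 2 * k) * (prod w A * prod w B) else 0) =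
       (\<Sum>B\<in>subsets_of_card (G - A) k. 2 ^ (card G - 2 * k) * (prod w A * prod w B))"
      using G by (simp only: sum.inter_filter finite_subsets_of_card)
  qed
  also have "\<dots> = 2 ^ (card G - 2 * k) * (\<Sum>A\<in>?S. prod w A * esym w k (G - A))"
    by (simp add: esym_def sum_distrib_left mult.assoc)
  also have "(\<Sum>A\<in>?S. prod w A * esym w k (G - A)) = int (2 * k choose k) * esym w (2 * k) G"
    using esym_expand[OF G, of k "2 * k" w] by simp
  finally show ?thesis .
qed

text \<open>The gain is in the order: a second moment of e_2k would involve 4k points at once,
  whereas second moments of the factors e_k involve only 2k. The bound averages over all
  bipartitions; it drops the factor \<open>2 * k choose k\<close>, which is at least 1, and is
  multiplied out to stay in the integers.\<close>

lemma abs_esym_double_le: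
  assumes G: "finite G"
  shows "2 ^ card G * \<bar>esym w (2 * k) G\<bar> \<le> 4 ^ k * (\<Sum>H\<in>Pow G. \<bar>esym w k H\<bar> * \<bar>esym w k (G - H)\<bar>)"
proof (cases "2 * k \<le> card G")
  case True
  have "2 ^ (card G - 2 * k) * \<bar>esym w (2 * k) G\<bar>
        \<le> 2 ^ (card G - 2 * k) * (int (2 * k choose k) * \<bar>esym w (2 * k) G\<bar>)"
  proof (intro mult_left_mono)
    have "1 \<le> int (2 * k choose k)" by (simp add: Suc_leI)
    then show "\<bar>esym w (2 * k) G\<bar> \<le> int (2 * k choose k) * \<bar>esym w (2 * k) G\<bar>"
      using mult_right_mono[of 1 "int (2 * k choose k)" "\<bar>esym w (2 * k) G\<bar>"] by simp
  qed simp
  also have "\<dots> = \<bar>\<Sum>H\<in>Pow G. esym w k H * esym w k (G - H)\<bar>"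
    unfolding sum_esym_bipartition[OF G] by (simp add: abs_mult)
  also have "\<dots> \<le> (\<Sum>H\<in>Pow G. \<bar>esym w k H\<bar> * \<bar>esym w k (G - H)\<bar>)"
    by (rule order_trans[OF sum_abs]) (simp add: abs_mult)
  finally have "4 ^ k * (2 ^ (card G - 2 * k) * \<bar>esym w (2 * k) G\<bar>)
      \<le> 4 ^ k * (\<Sum>H\<in>Pow G. \<bar>esym w k H\<bar> * \<bar>esym w k (G - H)\<bar>)"
    by (rule mult_left_mono) simp
  moreover have "(4::int) ^ k * 2 ^ (card G - 2 * k) = 2 ^ card G"
  proof -
    have "(4::int) ^ k = 2 ^ (2 * k)" by (simp add: power_mult)
    then show ?thesis using True by (simp add: power_add[symmetric])
  qed
  ultimately show ?thesis by (simp add: mult.assoc[symmetric])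
next
  \<comment> \<open>With truncated subtraction the power identity of the first case breaks down
    here, but there are no 2k-subsets at all.\<close>
  case False
  then have "esym w (2 * k) G = 0"
    using G by (simp add: esym_def subsets_of_card_empty)
  then show ?thesis by (simp add: sum_nonneg)
qed

lemma abs_prod_le_1:
  fixes w :: "'a \<Rightarrow> int"
  assumes "\<And>x. \<bar>w x\<bar> \<le> 1"
  shows "\<bar>prod w A\<bar> \<le> 1"
  unfolding abs_prod using prod_mono[of A "\<lambda>x. \<bar>w x\<bar>" "\<lambda>_. 1"] assms by simp

section \<open>Binomial coefficients and asymptotics\<close>

lemma real_binomial_le_pow_div_fact: "real (q choose j) \<le> real q ^ j / fact j"
proof -
  have "real ((q choose j) * fact j) \<le> real (q ^ j)"
    by (subst of_nat_le_iff) (rule binomial_fact_pow)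
  then show ?thesis by (simp add: field_simps)
qed

text \<open>Each factor q - i of the falling factorial is at least q - n, and by Bernoulli (1 -
  n/q)^n is at least 1 - n^2/q, hence at least 1/2.\<close>

lemma pow_div_fact_le_binomial:
  assumes n: "2 * n\<^sup>2 \<le> q"
  shows "real q ^ n / fact n \<le> 2 * real (q choose n)"
proof (cases "n = 0")
  case False
  have "n \<le> n\<^sup>2" by (simp add: power2_eq_square)
  with n False have q: "0 < q" "n \<le> q" by (auto intro: gr0I)
  have "1 / 2 \<le> 1 + real n * (- (real n / real q))"
    using n q by (simp add: field_simps power2_eq_square flip: of_nat_mult)
  also have "\<dots> \<le> (1 + (- (real n / real q))) ^ n"
    using q by (intro Bernoulli_inequality) (simp add: field_simps)
  finally have "real q ^ n * (1 / 2) \<le> real q ^ n * (1 + (- (real n / real q))) ^ n"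
    by (intro mult_left_mono) auto
  also have "\<dots> = (real q - real n) ^ n"
    using q by (simp add: power_mult_distrib[symmetric] field_simps)
  also have "\<dots> = (\<Prod>i = 0..<n. real q - real n)" by simp
  also have "\<dots> \<le> (\<Prod>i = 0..<n. real q - real i)"
    using q by (intro prod_mono) auto
  also have "\<dots> = fact n * real (q choose n)"
    by (simp add: binomial_gbinomial gbinomial_mult_fact)
  finally show ?thesis by (simp add: field_simps)
qed simp

lemma fact_le_pow_mult_fact: "(fact (m + t) :: real) \<le> real (m + t) ^ t * fact m"
proof (induction t)
  case (Suc t)
  have "(fact (m + Suc t) :: real) = real (m + Suc t) * fact (m + t)" by simp
  also have "\<dots> \<le> real (m + Suc t) * (real (m + t) ^ t * fact m)"
    using Suc by (intro mult_left_mono) auto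
  also have "\<dots> \<le> real (m + Suc t) * (real (m + Suc t) ^ t * fact m)"
    by (intro mult_left_mono mult_right_mono power_mono) auto
  finally show ?case by (simp add: mult.assoc)
qed simp

lemma asymp_equivI_rel_error:
  fixes f g \<delta> :: "'a \<Rightarrow> real"
  assumes err: "eventually (\<lambda>x. \<bar>f x - g x\<bar> \<le> \<delta> x * g x) F" and pos: "eventually (\<lambda>x. g x > 0) F"
    and \<delta>: "(\<delta> \<longlongrightarrow> 0) F"
  shows "f \<sim>[F] g"
proof (rule asymp_equivI')
  have "eventually (\<lambda>x. \<bar>f x / g x - 1\<bar> \<le> \<delta> x) F"
    using err pos
  proof eventually_elim
    case (elim x)
    have "f x / g x - 1 = (f x - g x) / g x"
      using elim by (simp add: diff_divide_distrib)
    then have "\<bar>f x / g x - 1\<bar> = \<bar>f x - g x\<bar> / g x"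
      using elim by (simp add: abs_divide)
    also have "\<dots> \<le> \<delta> x" using elim by (simp add: pos_divide_le_eq)
    finally show ?case .
  qed
  then have "((\<lambda>x. f x / g x - 1) \<longlongrightarrow> 0) F"
    by (intro tendsto_0_le[OF \<delta>, of _ 1]) (auto elim!: eventually_mono)
  then show "((\<lambda>x. f x / g x) \<longlongrightarrow> 1) F"
    by (simp add: LIM_zero_iff)
qed

text \<open>Passing from n to n + 4 adds 4n + 6, so the parity has period 4. It decides the sign
  \<open>\<eta> (\<ominus> \<one>) ^ (n choose 2)\<close> on which the case distinction modulo 4
  rests.\<close>

lemma even_choose_two_iff: "even (n choose 2) \<longleftrightarrow> n mod 4 = 0 \<or> n mod 4 = 1"
proof -
  have "even ((4 * j + r) choose 2) \<longleftrightarrow> r = 0 \<or> r = 1" if "r < 4" for j r :: nat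
  proof (induction j)
    case 0
    from that have "r = 0 \<or> r = 1 \<or> r = 2 \<or> r = 3" by auto
    then show ?case by (auto simp: choose_two)
  next
    case (Suc j)
    have "(4 * Suc j + r) choose 2 = ((4 * j + r) choose 2) + (4 * (4 * j + r) + 6)"
      by (simp add: numeral_eq_Suc)
    then show ?case using Suc by simp
  qed
  from this[of "n mod 4" "n div 4"] show ?thesis by simp
qed

lemma q_at_top_mono: "(\<And>q. P q \<Longrightarrow> Q q) \<Longrightarrow> q_at_top P \<le> q_at_top Q"
  unfolding q_at_top_def by (intro inf_mono) auto

lemma eventually_q_at_topI: "(\<And>q. odd_prime_power q \<Longrightarrow> P q \<Longrightarrow> Q q) \<Longrightarrow> eventually Q (q_at_top P)"
  unfolding q_at_top_def eventually_inf_principal by simp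

section \<open>The quadratic character of a finite field\<close>

locale odd_finite_field = field R for R (structure) +
  assumes fin: "finite (carrier R)" and odd_card: "odd (card (carrier R))"
begin

abbreviation \<eta> :: "'a \<Rightarrow> int" where "\<eta> \<equiv> quad_char R"

definition q :: nat where "q = card (carrier R)"

lemma q_ge_3: "q \<ge> 3"
proof -
  have "card {\<zero>, \<one>} \<le> q" unfolding q_def by (rule card_mono[OF fin]) auto
  then have "q \<ge> 2" by simp
  with odd_card show ?thesis unfolding q_def by presburger
qed

text \<open>A primitive element, with the enumeration of the nonzero elements and the order recorded
  in the notation of the field itself, so that later arguments need not return to the multiplicative
  group.\<close>

definition generator :: "'a \<Rightarrow> bool" where
  "generator a \<longleftrightarrow> a \<in> carrier R \<and> a \<noteq> \<zero> \<and>
     bij_betw (\<lambda>i::nat. a [^] i) {..<q - 1} (carrier R - {\<zero>}) \<and>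
     (\<forall>i::nat. a [^] i = \<one> \<longleftrightarrow> (q - 1) dvd i)"

lemma ex_generator: "\<exists>a. generator a"
proof -
  interpret G: group "mult_of R" by (rule field_mult_group)
  have finG: "finite (carrier (mult_of R))" using fin by simp
  obtain a where a: "a \<in> carrier (mult_of R)" "carrier (mult_of R) = {a [^] i | i::nat. i \<in> UNIV}"
    using finite_field_mult_group_has_gen[OF fin] by blast
  have elems: "carrier (mult_of R) = {a [^]\<^bsub>mult_of R\<^esub> i | i. i \<in> {0 .. G.ord a - 1}}"
    using G.ord_elems[OF finG a(1)] a(2) by (simp add: nat_pow_mult_of)
  have pos: "G.ord a \<ge> 1" by (rule G.ord_ge_1[OF finG a(1)])
  have set: "{0..G.ord a - 1} = {..<G.ord a}" using pos by auto
  have bij: "bij_betw (\<lambda>i::nat. a [^]\<^bsub>mult_of R\<^esub> i) {..<G.ord a} (carrier (mult_of R))"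
    unfolding bij_betw_def using G.ord_inj[OF a(1)] elems set by auto
  have ord: "G.ord a = q - 1"
    using bij_betw_same_card[OF bij] fin by (simp add: q_def)
  have "generator a"
    unfolding generator_def
  proof (intro conjI allI)
    show "a \<in> carrier R" "a \<noteq> \<zero>" using a by auto
    show "bij_betw (\<lambda>i::nat. a [^] i) {..<q - 1} (carrier R - {\<zero>})"
      using bij unfolding ord by (simp add: nat_pow_mult_of)
    show "a [^] i = \<one> \<longleftrightarrow> (q - 1) dvd i" for i :: nat
      using G.pow_eq_id[OF a(1), of i] unfolding ord by (simp add: nat_pow_mult_of)
  qed
  then show ?thesis ..
qed

text \<open>The order q - 1 is even, so the parity of an exponent is well defined, and the squares
  are exactly the even powers.\<close>

lemma quad_char_generator_pow:
  assumes "generator a"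
  shows "\<eta> (a [^] (i::nat)) = (- 1) ^ i"
proof -
  have a: "a \<in> carrier R" "a \<noteq> \<zero>"
    and bij: "bij_betw (\<lambda>i::nat. a [^] i) {..<q - 1} (carrier R - {\<zero>})"
    and ord: "\<And>i::nat. a [^] i = \<one> \<longleftrightarrow> (q - 1) dvd i"
    using assms by (auto simp: generator_def)
  have nz: "a [^] j \<noteq> \<zero>" for j :: nat
    using a by (induction j) (auto simp: integral_iff)
  have "even i" if y: "y \<in> carrier R" "a [^] i = y \<otimes> y" for y
  proof -
    have "y \<noteq> \<zero>" using y nz[of i] by auto
    then obtain j where j: "y = a [^] (j::nat)"
      using y(1) bij unfolding bij_betw_def by blast
    let ?N = "q - 1"
    have ij: "a [^] i = a [^] (2 * j)"
      using y(2) a by (simp add: j nat_pow_mult mult_2)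
    \<comment> \<open>The factor \<open>a [^] (2 * j * (?N - 1))\<close> is the inverse of
      \<open>a [^] (2 * j)\<close>; it replaces a subtraction of exponents in the naturals.\<close>
    have "a [^] (i + 2 * j * (?N - 1)) = a [^] i \<otimes> a [^] (2 * j * (?N - 1))"
      using a by (simp add: nat_pow_mult)
    also have "\<dots> = a [^] (2 * j + 2 * j * (?N - 1))"
      unfolding ij using a by (simp add: nat_pow_mult)
    also have "2 * j + 2 * j * (?N - 1) = ?N * (2 * j)"
    proof -
      obtain N where "?N = Suc N" using q_ge_3 by (cases ?N) auto
      then show ?thesis by (simp only: diff_Suc_1 mult_Suc) simp
    qed
    also have "a [^] (?N * (2 * j)) = \<one>" by (simp add: ord)
    finally have "?N dvd i + 2 * j * (?N - 1)" by (simp add: ord)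
    moreover have "even ?N" using odd_card by (simp add: q_def)
    ultimately have "even (i + 2 * j * (?N - 1))" by (rule dvd_trans[rotated])
    then show "even i" by simp
  qed
  moreover have "\<exists>y\<in>carrier R. a [^] i = y \<otimes> y" if "even i"
  proof -
    from that obtain j where "i = j + j" by (metis evenE mult_2)
    then show ?thesis using a by (auto simp: nat_pow_mult intro!: bexI[of _ "a [^] j"])
  qed
  ultimately have "(\<exists>y\<in>carrier R. a [^] i = y \<otimes> y) \<longleftrightarrow> even i" by blast
  then show ?thesis
    using nz[of i] by (cases "even i") (simp_all add: quad_char_def)
qed

lemma quad_char_zero [simp]: "\<eta> \<zero> = 0"
  by (simp add: quad_char_def)

lemma abs_quad_char_le_1: "\<bar>\<eta> x\<bar> \<le> 1"
  by (simp add: quad_char_def)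

lemma quad_char_nonzero: "x \<noteq> \<zero> \<Longrightarrow> \<eta> x = 1 \<or> \<eta> x = - 1"
  by (auto simp: quad_char_def)

lemma quad_char_mult:
  assumes x: "x \<in> carrier R" and y: "y \<in> carrier R"
  shows "\<eta> (x \<otimes> y) = \<eta> x * \<eta> y"
proof (cases "x = \<zero> \<or> y = \<zero>")
  case True
  then show ?thesis using x y by auto
next
  case False
  obtain a where gen: "generator a" using ex_generator ..
  then have a: "a \<in> carrier R" "a \<noteq> \<zero>"
    "bij_betw (\<lambda>i::nat. a [^] i) {..<q - 1} (carrier R - {\<zero>})"
    "\<And>i::nat. a [^] i = \<one> \<longleftrightarrow> (q - 1) dvd i"
    by (auto simp: generator_def)
  have "\<exists>i::nat. z = a [^] i" if "z \<in> carrier R - {\<zero>}" for z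
    using that a(3) unfolding bij_betw_def by blast
  then obtain i j where "x = a [^] (i::nat)" "y = a [^] (j::nat)"
    using x y False by blast
  then show ?thesis
    using a(1) by (simp add: nat_pow_mult quad_char_generator_pow[OF gen] power_add)
qed

lemma quad_char_minus_one: "\<eta> (\<ominus> \<one>) = (- 1) ^ ((q - 1) div 2)"
proof -
  obtain a where gen: "generator a" using ex_generator ..
  then have a: "a \<in> carrier R" "a \<noteq> \<zero>"
    "bij_betw (\<lambda>i::nat. a [^] i) {..<q - 1} (carrier R - {\<zero>})"
    "\<And>i::nat. a [^] i = \<one> \<longleftrightarrow> (q - 1) dvd i"
    by (auto simp: generator_def)
  \<comment> \<open>This element squares to one but is not one, because a has order q - 1; in a
    field it can only be minus one.\<close>
  define b where "b = a [^] ((q - 1) div 2)"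
  have bc: "b \<in> carrier R" using a by (simp add: b_def)
  have "even (q - 1)" using odd_card by (simp add: q_def)
  then have "(q - 1) div 2 + (q - 1) div 2 = q - 1" by presburger
  then have bb: "b \<otimes> b = \<one>" using a by (simp add: b_def nat_pow_mult)
  have "\<not> (q - 1) dvd (q - 1) div 2"
    using q_ge_3 by (auto dest!: dvd_imp_le)
  then have b1: "b \<noteq> \<one>" using a(4) by (simp add: b_def)
  have "(b \<ominus> \<one>) \<otimes> (b \<oplus> \<one>) = b \<otimes> b \<ominus> \<one>"
    using bc by algebra
  also have "\<dots> = \<zero>" using bc by (simp add: bb)
  finally have "b \<ominus> \<one> = \<zero> \<or> b \<oplus> \<one> = \<zero>"
    using bc by (simp add: integral_iff)
  moreover have "b \<ominus> \<one> \<noteq> \<zero>" using b1 bc by simp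
  ultimately have "b = \<ominus> \<one>"
    using bc by (metis minus_equality one_closed)
  then show ?thesis
    using quad_char_generator_pow[OF gen, of "(q - 1) div 2"] by (simp add: b_def)
qed

lemma quad_char_minus:
  "x \<in> carrier R \<Longrightarrow> \<eta> (\<ominus> x) = \<eta> (\<ominus> \<one>) * \<eta> x"
  using quad_char_mult[of "\<ominus> \<one>" x] by (simp add: l_minus)

lemma quad_char_diff_commute:
  assumes "x \<in> carrier R" "y \<in> carrier R"
  shows "\<eta> (x \<ominus> y) = \<eta> (\<ominus> \<one>) * \<eta> (y \<ominus> x)"
proof -
  have "x \<ominus> y = \<ominus> (y \<ominus> x)" using assms by algebra
  then show ?thesis using assms quad_char_minus[of "y \<ominus> x"] by simp
qed

lemma quad_char_finprod:
  "finite A \<Longrightarrow> f \<in> A \<rightarrow> carrier R \<Longrightarrow> \<eta> (\<Otimes>x\<in>A. f x) = (\<Prod>x\<in>A. \<eta> (f x))"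
proof (induction A rule: finite_induct)
  case empty
  have "\<exists>y\<in>carrier R. \<one> = y \<otimes> y" by (rule bexI[of _ \<one>]) auto
  then show ?case by (simp add: quad_char_def)
next
  case (insert x A)
  then show ?case by (simp add: finprod_insert quad_char_mult Pi_iff)
qed

text \<open>Along the powers of a generator the values alternate in sign, and there are evenly many
  of them.\<close>

lemma sum_quad_char: "(\<Sum>x\<in>carrier R. \<eta> x) = 0"
proof -
  obtain a where gen: "generator a" using ex_generator ..
  then have a: "a \<in> carrier R" "a \<noteq> \<zero>"
    "bij_betw (\<lambda>i::nat. a [^] i) {..<q - 1} (carrier R - {\<zero>})"
    "\<And>i::nat. a [^] i = \<one> \<longleftrightarrow> (q - 1) dvd i"
    by (auto simp: generator_def)
  have "(\<Sum>x\<in>carrier R. \<eta> x) = (\<Sum>x\<in>carrier R - {\<zero>}. \<eta> x)"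
    using fin by (intro sum.mono_neutral_right) auto
  also have "\<dots> = (\<Sum>i<q - 1. \<eta> (a [^] i))"
    by (rule sum.reindex_bij_betw[OF a(3), symmetric])
  also have "\<dots> = (\<Sum>i<q - 1. (- 1) ^ i)"
    by (simp add: quad_char_generator_pow[OF gen])
  also have "\<dots> = 0"
  proof -
    have "(\<Sum>i<2 * n. (- 1) ^ i) = (0::int)" for n :: nat
      by (induction n) auto
    moreover have "even (q - 1)" using odd_card by (simp add: q_def)
    ultimately show ?thesis by (metis dvdE)
  qed
  finally show ?thesis .
qed

lemma sum_quad_char_affine:
  assumes "b \<in> carrier R" "h \<in> carrier R" "h \<noteq> \<zero>"
  shows "(\<Sum>c\<in>carrier R. \<eta> (b \<oplus> c \<otimes> h)) = 0"
proof -
  have "inj_on (\<lambda>c. b \<oplus> c \<otimes> h) (carrier R)"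
    using assms by (auto simp: inj_on_def m_rcancel)
  moreover have "(\<lambda>c. b \<oplus> c \<otimes> h) ` carrier R \<subseteq> carrier R" using assms by auto
  ultimately have "bij_betw (\<lambda>c. b \<oplus> c \<otimes> h) (carrier R) (carrier R)"
    unfolding bij_betw_def using endo_inj_surj[OF fin] by blast
  from sum.reindex_bij_betw[OF this, of \<eta>] show ?thesis
    by (simp add: sum_quad_char)
qed

section \<open>Orthogonality over monic polynomials\<close>

text \<open>
  The functions on the field induced by the monic polynomials of degree \<open>d\<close>, in Horner form. Different
  polynomials may induce the same function, so there are at most, but not always exactly, \<open>q ^ d\<close>.
\<close>

primrec monic_funs :: "nat \<Rightarrow> ('a \<Rightarrow> 'a) set" where
  "monic_funs 0 = {\<lambda>u\<in>carrier R. \<one>}"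
| "monic_funs (Suc d) = (\<lambda>(f, c). \<lambda>u\<in>carrier R. u \<otimes> f u \<oplus> c) ` (monic_funs d \<times> carrier R)"

text \<open>The restriction to the field allows these functions to be literally members of
  \<open>monic_funs (card T)\<close>, whose elements are restricted in the same way.\<close>

definition root_fun :: "'a set \<Rightarrow> 'a \<Rightarrow> 'a" where
  "root_fun T = (\<lambda>u\<in>carrier R. \<Otimes>x\<in>T. u \<ominus> x)"

lemma monic_funs_SucI:
  assumes "f \<in> monic_funs d" "c \<in> carrier R" "\<And>u. u \<in> carrier R \<Longrightarrow> g u = u \<otimes> f u \<oplus> c"
  shows "(\<lambda>u\<in>carrier R. g u) \<in> monic_funs (Suc d)"
proof -
  have "(\<lambda>u\<in>carrier R. g u) = (\<lambda>u\<in>carrier R. u \<otimes> f u \<oplus> c)"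
    using assms(3) by (auto simp: restrict_def)
  then show ?thesis using assms(1,2) by force
qed

lemma monic_funs_SucE:
  assumes "g \<in> monic_funs (Suc d)"
  obtains f c where "f \<in> monic_funs d" "c \<in> carrier R" "g = (\<lambda>u\<in>carrier R. u \<otimes> f u \<oplus> c)"
  using assms by auto

lemma monic_funs_closed: "f \<in> monic_funs d \<Longrightarrow> f \<in> carrier R \<rightarrow>\<^sub>E carrier R"
proof (induction d arbitrary: f)
  case (Suc d)
  from Suc.prems obtain g c where g: "g \<in> monic_funs d" and c: "c \<in> carrier R"
    and f: "f = (\<lambda>u\<in>carrier R. u \<otimes> g u \<oplus> c)" by (rule monic_funs_SucE)
  have "g \<in> carrier R \<rightarrow>\<^sub>E carrier R" by (rule Suc.IH[OF g])
  then show ?case using c unfolding f by (auto simp: PiE_iff extensional_def)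
qed auto

lemma monic_funs_apply_closed: "f \<in> monic_funs d \<Longrightarrow> u \<in> carrier R \<Longrightarrow> f u \<in> carrier R"
  using monic_funs_closed by blast

lemma finite_monic_funs: "finite (monic_funs d)"
  using fin by (induction d) auto

lemma card_monic_funs_le: "card (monic_funs d) \<le> q ^ d"
proof (induction d)
  case (Suc d)
  have "card (monic_funs (Suc d)) \<le> card (monic_funs d \<times> carrier R)"
    unfolding monic_funs.simps by (rule card_image_le) (simp add: finite_monic_funs fin)
  also have "\<dots> \<le> q ^ d * q"
    using Suc by (simp add: card_cartesian_product q_def)
  finally show ?case by (simp add: mult.commute)
qed auto

text \<open>Horner form only offers multiplication by u followed by adding a constant. For f = u g +
  c one has (u - x) f = u ((u - x) g + c) - c x; by induction (u - x) g is again in Horner form, and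
  c is absorbed into its constant term.\<close>

lemma monic_funs_mult_linear:
  "f \<in> monic_funs d \<Longrightarrow> x \<in> carrier R \<Longrightarrow> (\<lambda>u\<in>carrier R. (u \<ominus> x) \<otimes> f u) \<in> monic_funs (Suc d)"
proof (induction d arbitrary: f)
  case 0
  show ?case
  proof (rule monic_funs_SucI[of "\<lambda>u\<in>carrier R. \<one>" _ "\<ominus> x"])
    fix u assume u: "u \<in> carrier R"
    then show "(u \<ominus> x) \<otimes> f u = u \<otimes> (\<lambda>u\<in>carrier R. \<one>) u \<oplus> \<ominus> x"
      using 0 by (simp add: minus_eq)
  qed (use 0 in auto)
next
  case (Suc d)
  from Suc.prems(1) obtain g c where g: "g \<in> monic_funs d" and c: "c \<in> carrier R"
    and f: "f = (\<lambda>u\<in>carrier R. u \<otimes> g u \<oplus> c)" by (rule monic_funs_SucE)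
  from Suc.IH[OF g Suc.prems(2)] obtain g' c' where g': "g' \<in> monic_funs d" and c': "c' \<in> carrier R"
    and eq: "(\<lambda>u\<in>carrier R. (u \<ominus> x) \<otimes> g u) = (\<lambda>u\<in>carrier R. u \<otimes> g' u \<oplus> c')" by (rule monic_funs_SucE)
  have 1: "(\<lambda>u\<in>carrier R. u \<otimes> g' u \<oplus> (c' \<oplus> c)) \<in> monic_funs (Suc d)"
    by (rule monic_funs_SucI[OF g']) (use c c' in auto)
  show ?case
  proof (rule monic_funs_SucI[OF 1, of "\<ominus> (c \<otimes> x)"])
    fix u assume u: "u \<in> carrier R"
    have gu: "g u \<in> carrier R" "g' u \<in> carrier R"
      using monic_funs_apply_closed g g' u by auto
    have eq': "(u \<ominus> x) \<otimes> g u = u \<otimes> g' u \<oplus> c'"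
      using fun_cong[OF eq, of u] u by simp
    have "(u \<ominus> x) \<otimes> (u \<otimes> g u \<oplus> c) = u \<otimes> ((u \<ominus> x) \<otimes> g u \<oplus> c) \<oplus> \<ominus> (c \<otimes> x)"
      using u gu c Suc.prems(2) by algebra
    also have "\<dots> = u \<otimes> (u \<otimes> g' u \<oplus> (c' \<oplus> c)) \<oplus> \<ominus> (c \<otimes> x)"
      unfolding eq' using u gu c c' by (simp add: a_assoc)
    finally show "(u \<ominus> x) \<otimes> f u = u \<otimes> (\<lambda>u\<in>carrier R. u \<otimes> g' u \<oplus> (c' \<oplus> c)) u \<oplus> \<ominus> (c \<otimes> x)"
      using u by (simp add: f)
  qed (use c Suc.prems in auto)
qed

lemma root_fun_in_monic_funs:
  assumes "finite T" "T \<subseteq> carrier R"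
  shows "root_fun T \<in> monic_funs (card T)"
  using assms
proof (induction T rule: finite_induct)
  case empty
  then show ?case by (simp add: root_fun_def restrict_def)
next
  case (insert x T)
  have "(\<lambda>u\<in>carrier R. (u \<ominus> x) \<otimes> root_fun T u) \<in> monic_funs (Suc (card T))"
    by (rule monic_funs_mult_linear) (use insert in auto)
  moreover have "(\<lambda>u\<in>carrier R. (u \<ominus> x) \<otimes> root_fun T u) = root_fun (insert x T)"
  proof
    fix u
    show "(\<lambda>u\<in>carrier R. (u \<ominus> x) \<otimes> root_fun T u) u = root_fun (insert x T) u"
    proof (cases "u \<in> carrier R")
      case True
      then have "(\<lambda>x. u \<ominus> x) \<in> T \<rightarrow> carrier R" "u \<ominus> x \<in> carrier R"
        using insert.prems by auto
      with True insert show ?thesis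
        by (simp add: root_fun_def finprod_insert)
    qed (simp add: root_fun_def)
  qed
  ultimately show ?case using insert by simp
qed

lemma quad_char_root_fun:
  assumes "T \<subseteq> carrier R" "u \<in> carrier R"
  shows "\<eta> (root_fun T u) = (\<Prod>x\<in>T. \<eta> (u \<ominus> x))"
proof -
  have "finite T" using assms fin finite_subset by blast
  moreover have "(\<lambda>x. u \<ominus> x) \<in> T \<rightarrow> carrier R" using assms by auto
  ultimately show ?thesis
    using assms(2) quad_char_finprod[of T "\<lambda>x. u \<ominus> x"] by (simp add: root_fun_def)
qed

lemma quad_char_eq_0_iff: "\<eta> x = 0 \<longleftrightarrow> x = \<zero>"
  by (simp add: quad_char_def)

text \<open>Since \<open>\<eta>\<close> vanishes only at zero and turns the field product into an
  integer product, the zeros can be read off from the integer factors.\<close>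

lemma root_fun_eq_0_iff:
  assumes "T \<subseteq> carrier R" "u \<in> carrier R"
  shows "root_fun T u = \<zero> \<longleftrightarrow> u \<in> T"
proof -
  have "finite T" using assms fin finite_subset by blast
  moreover have "u \<ominus> x = \<zero> \<longleftrightarrow> u = x" if "x \<in> T" for x
    using that assms by auto
  ultimately show ?thesis
    using quad_char_root_fun[OF assms]
    by (metis (no_types, lifting) prod_zero_iff quad_char_eq_0_iff)
qed

text \<open>T is recovered from its function as the set of zeros.\<close>

lemma inj_on_root_fun: "inj_on root_fun (Pow (carrier R))"
proof (rule inj_onI)
  fix S T assume ST: "S \<in> Pow (carrier R)" "T \<in> Pow (carrier R)" "root_fun S = root_fun T"
  then have "u \<in> S \<longleftrightarrow> u \<in> T" if "u \<in> carrier R" for u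
    using root_fun_eq_0_iff[of S u] root_fun_eq_0_iff[of T u] that by auto
  then show "S = T" using ST by auto
qed

text \<open>A summand of lower degree leaves the leading coefficient alone. In Horner form both
  constant terms are peeled off until g has degree 0, where the multiple of g is just a
  constant.\<close>

lemma monic_funs_add_smult:
  "f \<in> monic_funs d \<Longrightarrow> g \<in> monic_funs s \<Longrightarrow> s < d \<Longrightarrow> c \<in> carrier R \<Longrightarrow>
   (\<lambda>u\<in>carrier R. f u \<oplus> c \<otimes> g u) \<in> monic_funs d"
proof (induction d arbitrary: f g s)
  case (Suc d)
  from Suc.prems(1) obtain f' a where f': "f' \<in> monic_funs d" and a: "a \<in> carrier R"
    and f: "f = (\<lambda>u\<in>carrier R. u \<otimes> f' u \<oplus> a)" by (rule monic_funs_SucE)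
  show ?case
  proof (cases s)
    case 0
    show ?thesis
    proof (rule monic_funs_SucI[OF f', of "a \<oplus> c"])
      fix u assume u: "u \<in> carrier R"
      then show "f u \<oplus> c \<otimes> g u = u \<otimes> f' u \<oplus> (a \<oplus> c)"
        using a Suc.prems 0 monic_funs_apply_closed[OF f' u] by (simp add: f a_assoc)
    qed (use a Suc.prems in auto)
  next
    case (Suc s')
    with Suc.prems(2) obtain g' b where g': "g' \<in> monic_funs s'" and b: "b \<in> carrier R"
      and g: "g = (\<lambda>u\<in>carrier R. u \<otimes> g' u \<oplus> b)" using monic_funs_SucE by metis
    have IH: "(\<lambda>u\<in>carrier R. f' u \<oplus> c \<otimes> g' u) \<in> monic_funs d"
      by (rule Suc.IH[OF f' g' _ Suc.prems(4)]) (use Suc Suc.prems(3) in simp)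
    show ?thesis
    proof (rule monic_funs_SucI[OF IH, of "a \<oplus> c \<otimes> b"])
      fix u assume u: "u \<in> carrier R"
      have "f' u \<in> carrier R" "g' u \<in> carrier R"
        using monic_funs_apply_closed f' g' u by auto
      then have "u \<otimes> f' u \<oplus> a \<oplus> c \<otimes> (u \<otimes> g' u \<oplus> b) = u \<otimes> (f' u \<oplus> c \<otimes> g' u) \<oplus> (a \<oplus> c \<otimes> b)"
        using u a b Suc.prems(4) by algebra
      then show "f u \<oplus> c \<otimes> g u = u \<otimes> (\<lambda>u\<in>carrier R. f' u \<oplus> c \<otimes> g' u) u \<oplus> (a \<oplus> c \<otimes> b)"
        using u by (simp add: f g)
    qed (use a b Suc.prems in auto)
  qed
qed auto

text \<open>
  Adding \<open>c h\<close> to \<open>f\<close>, where \<open>h\<close> is monic with root set \<open>V\<close>, permutes the monic polynomials, fixes the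
  values on \<open>V\<close> and, as \<open>c\<close> varies, spreads the value at \<open>u\<close> uniformly over the field.
\<close>
lemma sum_monic_funs_quad_char_eq_0:
  assumes u: "u \<in> carrier R" "u \<notin> V" and V: "V \<subseteq> carrier R" "card V < d"
    and \<Psi>: "\<And>f g. (\<And>v. v \<in> V \<Longrightarrow> f v = g v) \<Longrightarrow> \<Psi> f = \<Psi> g"
  shows "(\<Sum>f\<in>monic_funs d. \<eta> (f u) * \<Psi> f) = 0"
proof -
  define h where "h = root_fun V"
  define \<tau> where "\<tau> c f = (\<lambda>v\<in>carrier R. f v \<oplus> c \<otimes> h v)" for c f
  have h: "h \<in> monic_funs (card V)"
    unfolding h_def by (rule root_fun_in_monic_funs) (use V fin finite_subset in blast)+
  have hv: "h v = \<zero>" if "v \<in> V" for v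
    using root_fun_eq_0_iff[OF V(1) subsetD[OF V(1) that]] that by (simp add: h_def)
  have hu: "h u \<noteq> \<zero>" "h u \<in> carrier R"
    using u V monic_funs_apply_closed[OF h] by (auto simp: h_def root_fun_eq_0_iff)
  have \<tau>_inv: "\<tau> (\<ominus> c) (\<tau> c f) = f" "\<tau> c (\<tau> (\<ominus> c) f) = f"
    if "c \<in> carrier R" "f \<in> monic_funs d" for c f
  proof -
    have "f v \<oplus> c \<otimes> h v \<oplus> (\<ominus> c) \<otimes> h v = f v" "f v \<oplus> (\<ominus> c) \<otimes> h v \<oplus> c \<otimes> h v = f v"
      if v: "v \<in> carrier R" for v
    proof -
      have "f v \<in> carrier R" "h v \<in> carrier R"
        using monic_funs_apply_closed[OF _ v] \<open>f \<in> monic_funs d\<close> h by auto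
      then show "f v \<oplus> c \<otimes> h v \<oplus> (\<ominus> c) \<otimes> h v = f v" "f v \<oplus> (\<ominus> c) \<otimes> h v \<oplus> c \<otimes> h v = f v"
        using \<open>c \<in> carrier R\<close> by algebra+
    qed
    moreover have "f v = undefined" if "v \<notin> carrier R" for v
      using monic_funs_closed[OF \<open>f \<in> monic_funs d\<close>] that by (auto simp: PiE_iff extensional_def)
    ultimately show "\<tau> (\<ominus> c) (\<tau> c f) = f" "\<tau> c (\<tau> (\<ominus> c) f) = f"
      by (auto simp: \<tau>_def fun_eq_iff)
  qed
  have \<tau>_closed: "\<tau> c f \<in> monic_funs d" if "c \<in> carrier R" "f \<in> monic_funs d" for c f
    unfolding \<tau>_def by (rule monic_funs_add_smult[OF that(2) h V(2) that(1)])
  have shift: "(\<Sum>f\<in>monic_funs d. \<eta> (f u) * \<Psi> f) = (\<Sum>f\<in>monic_funs d. \<eta> (f u \<oplus> c \<otimes> h u) * \<Psi> f)"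
    if c: "c \<in> carrier R" for c
  proof -
    have "(\<Sum>f\<in>monic_funs d. \<eta> (f u) * \<Psi> f) = (\<Sum>f\<in>monic_funs d. \<eta> (\<tau> c f u) * \<Psi> (\<tau> c f))"
      by (rule sum.reindex_bij_witness[of _ "\<tau> c" "\<tau> (\<ominus> c)"]) (use c \<tau>_inv \<tau>_closed in auto)
    also have "\<dots> = (\<Sum>f\<in>monic_funs d. \<eta> (f u \<oplus> c \<otimes> h u) * \<Psi> f)"
    proof (rule sum.cong[OF refl])
      fix f assume f: "f \<in> monic_funs d"
      have "\<Psi> (\<tau> c f) = \<Psi> f"
      proof (rule \<Psi>)
        fix v assume "v \<in> V"
        then show "\<tau> c f v = f v"
          using V hv c monic_funs_apply_closed[OF f] by (auto simp: \<tau>_def)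
      qed
      then show "\<eta> (\<tau> c f u) * \<Psi> (\<tau> c f) = \<eta> (f u \<oplus> c \<otimes> h u) * \<Psi> f"
        using u by (simp add: \<tau>_def)
    qed
    finally show ?thesis .
  qed
  \<comment> \<open>All q shifts yield the same sum, so q times it may be summed over c first; that
    inner sum is a complete affine character sum because \<open>h u\<close> is nonzero.\<close>
  have "int q * (\<Sum>f\<in>monic_funs d. \<eta> (f u) * \<Psi> f) =
        (\<Sum>c\<in>carrier R. \<Sum>f\<in>monic_funs d. \<eta> (f u) * \<Psi> f)"
    by (simp add: q_def)
  also have "\<dots> = (\<Sum>c\<in>carrier R. \<Sum>f\<in>monic_funs d. \<eta> (f u \<oplus> c \<otimes> h u) * \<Psi> f)"
    by (rule sum.cong[OF refl shift])
  also have "\<dots> = (\<Sum>f\<in>monic_funs d. \<Sum>c\<in>carrier R. \<eta> (f u \<oplus> c \<otimes> h u) * \<Psi> f)"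
    by (rule sum.swap)
  also have "\<dots> = (\<Sum>f\<in>monic_funs d. (\<Sum>c\<in>carrier R. \<eta> (f u \<oplus> c \<otimes> h u)) * \<Psi> f)"
    by (simp add: sum_distrib_right)
  also have "\<dots> = 0"
    using sum_quad_char_affine[OF _ hu(2,1)] monic_funs_apply_closed u by simp
  finally show ?thesis using q_ge_3 by simp
qed

text \<open>In the expanded square only the diagonal survives: the mixed terms vanish by
  orthogonality, and each of the at most \<open>q choose k\<close> diagonal terms is at most the
  number of functions.\<close>

lemma sum_monic_funs_esym_square_le:
  assumes H: "H \<subseteq> carrier R" and k: "2 * k \<le> d"
  shows "(\<Sum>f\<in>monic_funs d. (esym (\<lambda>u. \<eta> (f u)) k H)\<^sup>2) \<le> int (q ^ d * (q choose k))"
proof -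
  let ?S = "subsets_of_card H k" and ?w = "\<lambda>f u. \<eta> (f u)"
  have finH: "finite H" using H fin finite_subset by blast
  have off: "(\<Sum>f\<in>monic_funs d. prod (?w f) A * prod (?w f) B) = 0"
    if AB: "A \<in> ?S" "B \<in> ?S" "A \<noteq> B" for A B
  proof -
    have fAB: "finite A" "finite B" "card A = k" "card B = k" "A \<subseteq> H" "B \<subseteq> H"
      using AB subsets_of_cardD finH by metis+
    then have "\<not> A \<subseteq> B" using \<open>A \<noteq> B\<close> card_subset_eq[of B A] by auto
    then obtain u where u: "u \<in> A" "u \<notin> B" by auto
    \<comment> \<open>Apart from u the mixed product depends on f only through these at most 2k - 1
      points. This is fewer than d, and u is not among them, so the factor at u averages to
      zero.\<close>
    define V where "V = (A - {u}) \<union> B"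
    have "card V \<le> card (A - {u}) + card B" unfolding V_def by (rule card_Un_le)
    also have "\<dots> < d"
    proof -
      have "card A > 0" using u fAB by (auto simp: card_gt_0_iff)
      then show ?thesis using u fAB k by (simp add: card_Diff_singleton)
    qed
    finally have V: "card V < d" .
    have "(\<Sum>f\<in>monic_funs d. \<eta> (f u) * (prod (?w f) (A - {u}) * prod (?w f) B)) = 0"
    proof (rule sum_monic_funs_quad_char_eq_0[of u V])
      fix f g :: "'a \<Rightarrow> 'a" assume fg: "\<And>v. v \<in> V \<Longrightarrow> f v = g v"
      have "prod (?w f) (A - {u}) = prod (?w g) (A - {u})" "prod (?w f) B = prod (?w g) B"
        by (rule prod.cong; simp add: fg V_def)+
      then show "prod (?w f) (A - {u}) * prod (?w f) B = prod (?w g) (A - {u}) * prod (?w g) B" by simp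
    qed (use u fAB H V in \<open>auto simp: V_def\<close>)
    moreover have "prod (?w f) A = \<eta> (f u) * prod (?w f) (A - {u})" for f
      using fAB u by (simp add: prod.remove)
    ultimately show ?thesis by (simp add: mult.assoc)
  qed
  have diag: "(\<Sum>f\<in>monic_funs d. prod (?w f) A * prod (?w f) A) \<le> int (q ^ d)" for A
  proof -
    have "prod (?w f) A * prod (?w f) A \<le> 1" for f
      using abs_prod_le_1[of "?w f" A] abs_quad_char_le_1
      by (metis abs_le_square_iff abs_one one_power2 power2_eq_square)
    then have "(\<Sum>f\<in>monic_funs d. prod (?w f) A * prod (?w f) A) \<le> (\<Sum>f\<in>monic_funs d. 1)"
      by (intro sum_mono)
    also have "\<dots> \<le> int (q ^ d)" using card_monic_funs_le[of d] by (simp flip: of_nat_power)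
    finally show ?thesis .
  qed
  have "(\<Sum>f\<in>monic_funs d. (esym (?w f) k H)\<^sup>2) =
        (\<Sum>f\<in>monic_funs d. \<Sum>A\<in>?S. \<Sum>B\<in>?S. prod (?w f) A * prod (?w f) B)"
    by (simp add: esym_def power2_eq_square sum_product)
  also have "\<dots> = (\<Sum>A\<in>?S. \<Sum>f\<in>monic_funs d. \<Sum>B\<in>?S. prod (?w f) A * prod (?w f) B)"
    by (rule sum.swap)
  also have "\<dots> = (\<Sum>A\<in>?S. \<Sum>B\<in>?S. \<Sum>f\<in>monic_funs d. prod (?w f) A * prod (?w f) B)"
    by (intro sum.cong refl sum.swap)
  also have "\<dots> = (\<Sum>A\<in>?S. \<Sum>f\<in>monic_funs d. prod (?w f) A * prod (?w f) A)"
  proof (rule sum.cong[OF refl])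
    fix A assume A: "A \<in> ?S"
    have "(\<Sum>B\<in>?S. \<Sum>f\<in>monic_funs d. prod (?w f) A * prod (?w f) B) =
          (\<Sum>B\<in>{A}. \<Sum>f\<in>monic_funs d. prod (?w f) A * prod (?w f) B)"
      by (rule sum.mono_neutral_right) (use A finH off in auto)
    then show "(\<Sum>B\<in>?S. \<Sum>f\<in>monic_funs d. prod (?w f) A * prod (?w f) B) =
      (\<Sum>f\<in>monic_funs d. prod (?w f) A * prod (?w f) A)" by simp
  qed
  also have "\<dots> \<le> (\<Sum>A\<in>?S. int (q ^ d))"
    by (intro sum_mono diag)
  also have "\<dots> = int ((card H choose k) * q ^ d)"
    using finH by (simp add: card_subsets_of_card)
  also have "\<dots> \<le> int (q ^ d * (q choose k))"
  proof -
    have "card H \<le> q" unfolding q_def using H fin by (rule card_mono[rotated])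
    then have "(card H choose k) \<le> (q choose k)" by (rule binomial_right_mono)
    then show ?thesis by (simp only: of_nat_le_iff mult.commute[of "q ^ d"] mult_le_mono1)
  qed
  finally show ?thesis .
qed

text \<open>On the field this is the function chi_T. It is written as a product of character values,
  because this form shows the symmetry between roots and evaluation points.\<close>

definition char_of_roots :: "'a set \<Rightarrow> 'a \<Rightarrow> int" where
  "char_of_roots T u = (\<Prod>x\<in>T. \<eta> (u \<ominus> x))"

text \<open>The root functions of distinct sets are distinct members of \<open>monic_funs t\<close>,
  and squares are nonnegative, so the sum may be enlarged to the whole family. Replacing the
  \<open>q choose t\<close> split polynomials by up to q^t functions is where the factor t! is
  lost.\<close>

lemma sum_roots_esym_square_le:
  assumes H: "H \<subseteq> carrier R" and k: "2 * k \<le> t"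
  shows "(\<Sum>T\<in>subsets_of_card (carrier R) t. (esym (char_of_roots T) k H)\<^sup>2) \<le> int (q ^ t * (q choose k))"
proof -
  let ?S = "subsets_of_card (carrier R) t"
  have "esym (char_of_roots T) k H = esym (\<lambda>u. \<eta> (root_fun T u)) k H" if "T \<in> ?S" for T
    unfolding esym_def using H subsets_of_cardD(1)[OF that]
    by (intro sum.cong prod.cong refl)
       (auto simp: char_of_roots_def quad_char_root_fun dest!: subsets_of_cardD(1))
  then have "(\<Sum>T\<in>?S. (esym (char_of_roots T) k H)\<^sup>2) =
        (\<Sum>T\<in>?S. (esym (\<lambda>u. \<eta> (root_fun T u)) k H)\<^sup>2)" by simp
  also have "\<dots> = (\<Sum>f\<in>root_fun ` ?S. (esym (\<lambda>u. \<eta> (f u)) k H)\<^sup>2)"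
    by (subst sum.reindex) (auto intro: inj_on_subset[OF inj_on_root_fun] dest: subsets_of_cardD(1))
  also have "\<dots> \<le> (\<Sum>f\<in>monic_funs t. (esym (\<lambda>u. \<eta> (f u)) k H)\<^sup>2)"
  proof (rule sum_mono2[OF finite_monic_funs])
    show "root_fun ` ?S \<subseteq> monic_funs t"
    proof (rule image_subsetI)
      fix T assume "T \<in> ?S"
      then show "root_fun T \<in> monic_funs t"
        using root_fun_in_monic_funs[of T] subsets_of_cardD[of T "carrier R" t] fin by simp
    qed
  qed auto
  also have "\<dots> \<le> int (q ^ t * (q choose k))" by (rule sum_monic_funs_esym_square_le[OF assms])
  finally show ?thesis .
qed

section \<open>Bipartite character sums\<close>


text \<open>The first index is the size of the root set, the second the number of evaluation points.
  Disjointness is not imposed: \<open>char_of_roots T\<close> vanishes on T, so overlapping pairs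
  contribute nothing.\<close>

definition pair_sum :: "nat \<Rightarrow> nat \<Rightarrow> int" where
  "pair_sum t m = (\<Sum>T\<in>subsets_of_card (carrier R) t. esym (char_of_roots T) m (carrier R))"

lemma abs_char_of_roots_le_1: "\<bar>char_of_roots T u\<bar> \<le> 1"
  unfolding char_of_roots_def by (rule abs_prod_le_1) (rule abs_quad_char_le_1)

lemma quad_char_minus_one_cases: "\<eta> (\<ominus> \<one>) = 1 \<or> \<eta> (\<ominus> \<one>) = - 1"
  unfolding quad_char_minus_one by (cases "even ((q - 1) div 2)") auto

text \<open>Exchanging roots and points replaces each u - x by x - u, which costs only the sign
  \<open>\<eta> (\<ominus> \<one>) ^ (t * m)\<close>.\<close>

lemma abs_pair_sum_commute: "\<bar>pair_sum t m\<bar> = \<bar>pair_sum m t\<bar>"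
proof -
  let ?C = "carrier R" and ?\<epsilon> = "\<eta> (\<ominus> \<one>)"
  have eq: "(\<Prod>u\<in>U. char_of_roots T u) = ?\<epsilon> ^ (t * m) * (\<Prod>x\<in>T. char_of_roots U x)"
    if T: "T \<in> subsets_of_card ?C t" and U: "U \<in> subsets_of_card ?C m" for T U
  proof -
    have sub: "T \<subseteq> ?C" "U \<subseteq> ?C" "card T = t" "card U = m"
      using subsets_of_cardD[OF T] subsets_of_cardD[OF U] by auto
    have "(\<Prod>u\<in>U. char_of_roots T u) = (\<Prod>u\<in>U. \<Prod>x\<in>T. ?\<epsilon> * \<eta> (x \<ominus> u))"
      unfolding char_of_roots_def using sub
      by (intro prod.cong refl quad_char_diff_commute) auto
    also have "\<dots> = ?\<epsilon> ^ (t * m) * (\<Prod>u\<in>U. \<Prod>x\<in>T. \<eta> (x \<ominus> u))"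
      using sub by (simp add: prod.distrib power_mult)
    also have "(\<Prod>u\<in>U. \<Prod>x\<in>T. \<eta> (x \<ominus> u)) = (\<Prod>x\<in>T. char_of_roots U x)"
      unfolding char_of_roots_def by (rule prod.swap)
    finally show ?thesis .
  qed
  have "pair_sum t m = (\<Sum>T\<in>subsets_of_card ?C t. \<Sum>U\<in>subsets_of_card ?C m.
          ?\<epsilon> ^ (t * m) * (\<Prod>x\<in>T. char_of_roots U x))"
    unfolding pair_sum_def esym_def by (intro sum.cong refl eq)
  also have "\<dots> = (\<Sum>U\<in>subsets_of_card ?C m. \<Sum>T\<in>subsets_of_card ?C t.
          ?\<epsilon> ^ (t * m) * (\<Prod>x\<in>T. char_of_roots U x))"
    by (rule sum.swap)
  also have "\<dots> = ?\<epsilon> ^ (t * m) * pair_sum m t"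
    by (simp add: pair_sum_def esym_def sum_distrib_left)
  finally show ?thesis
    using quad_char_minus_one_cases by (auto simp: abs_mult power_abs)
qed

lemma esym_1: "esym w 1 G = sum w G"
  unfolding esym_def subsets_of_card_1 by (subst sum.reindex) auto

text \<open>For a single root the second moment method would have k = 0 and save nothing. Instead
  e_m is reduced to e_1 on the complement of an (m-1)-set W; as the complete sum vanishes, e_1 there
  is minus the sum over W, of size at most m, and this m cancels the binomial factor of the
  expansion.\<close>

lemma abs_pair_sum_1_le:
  assumes m: "m \<ge> 1"
  shows "\<bar>pair_sum 1 m\<bar> \<le> int (q * (q choose (m - 1)))"
proof -
  let ?C = "carrier R"
  have "\<bar>esym (char_of_roots {x}) m ?C\<bar> \<le> int (q choose (m - 1))" if x: "x \<in> ?C" for x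
  proof -
    let ?w = "char_of_roots {x}"
    have "sum ?w ?C = (\<Sum>c\<in>?C. \<eta> (\<ominus> x \<oplus> c \<otimes> \<one>))"
      using x by (intro sum.cong refl) (simp add: char_of_roots_def minus_eq a_comm)
    also have "\<dots> = 0" using x by (intro sum_quad_char_affine) auto
    finally have tot: "sum ?w ?C = 0" .
    have bd: "\<bar>esym ?w 1 (?C - W)\<bar> \<le> int m" if W: "W \<in> subsets_of_card ?C (m - 1)" for W
    proof -
      have "sum ?w (?C - W) = - sum ?w W"
        using tot sum.subset_diff[OF subsets_of_cardD(1)[OF W] fin, of ?w] by simp
      then have "\<bar>esym ?w 1 (?C - W)\<bar> = \<bar>sum ?w W\<bar>" by (simp only: esym_1 abs_minus_cancel)
      also have "\<dots> \<le> (\<Sum>u\<in>W. \<bar>?w u\<bar>)" by (rule sum_abs)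
      also have "\<dots> \<le> (\<Sum>u\<in>W. 1)" by (intro sum_mono abs_char_of_roots_le_1)
      finally show ?thesis using subsets_of_cardD(2)[OF W] m by simp
    qed
    have "int m * \<bar>esym ?w m ?C\<bar> = \<bar>\<Sum>W\<in>subsets_of_card ?C (m - 1). prod ?w W * esym ?w 1 (?C - W)\<bar>"
      unfolding esym_expand[OF fin m, of ?w, symmetric] by (simp add: abs_mult)
    also have "\<dots> \<le> (\<Sum>W\<in>subsets_of_card ?C (m - 1). \<bar>prod ?w W\<bar> * \<bar>esym ?w 1 (?C - W)\<bar>)"
      by (rule order_trans[OF sum_abs]) (simp add: abs_mult)
    also have "\<dots> \<le> (\<Sum>W\<in>subsets_of_card ?C (m - 1). 1 * int m)"
      by (intro sum_mono mult_mono abs_prod_le_1 abs_char_of_roots_le_1 bd) auto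
    also have "\<dots> = int m * int (q choose (m - 1))"
      using fin by (simp add: card_subsets_of_card q_def)
    finally show ?thesis using m by simp
  qed
  then have "(\<Sum>x\<in>?C. \<bar>esym (char_of_roots {x}) m ?C\<bar>) \<le> (\<Sum>x\<in>?C. int (q choose (m - 1)))"
    by (intro sum_mono)
  moreover have eq: "pair_sum 1 m = (\<Sum>x\<in>?C. esym (char_of_roots {x}) m ?C)"
    unfolding pair_sum_def subsets_of_card_1 by (subst sum.reindex) auto
  have "\<bar>pair_sum 1 m\<bar> \<le> (\<Sum>x\<in>?C. \<bar>esym (char_of_roots {x}) m ?C\<bar>)"
    unfolding eq by (rule sum_abs)
  ultimately show ?thesis by (simp add: q_def)
qed

text \<open>The bipartitions do not depend on T, so for each H the sum over T is bounded first:
  2|ab| is at most a^2 + b^2, and both second moments are known.\<close>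

lemma sum_roots_abs_esym_double_le:
  assumes G: "G \<subseteq> carrier R" and k: "2 * k \<le> t"
  shows "(\<Sum>T\<in>subsets_of_card (carrier R) t. \<bar>esym (char_of_roots T) (2 * k) G\<bar>)
         \<le> int (4 ^ k * (q ^ t * (q choose k)))"
proof -
  let ?S = "subsets_of_card (carrier R) t" and ?e = "\<lambda>T. esym (char_of_roots T) k"
  let ?B = "int (q ^ t * (q choose k))"
  have finG: "finite G" using G fin finite_subset by blast
  have pair: "(\<Sum>T\<in>?S. \<bar>?e T H\<bar> * \<bar>?e T (G - H)\<bar>) \<le> ?B" if H: "H \<in> Pow G" for H
  proof -
    have "2 * (\<Sum>T\<in>?S. \<bar>?e T H\<bar> * \<bar>?e T (G - H)\<bar>) = (\<Sum>T\<in>?S. 2 * \<bar>?e T H\<bar> * \<bar>?e T (G - H)\<bar>)"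
      by (simp add: sum_distrib_left mult.assoc)
    also have "\<dots> \<le> (\<Sum>T\<in>?S. (?e T H)\<^sup>2 + (?e T (G - H))\<^sup>2)"
    proof (rule sum_mono)
      fix T
      show "2 * \<bar>?e T H\<bar> * \<bar>?e T (G - H)\<bar> \<le> (?e T H)\<^sup>2 + (?e T (G - H))\<^sup>2"
        using zero_le_power2[of "\<bar>?e T H\<bar> - \<bar>?e T (G - H)\<bar>"]
        by (simp add: power2_diff)
    qed
    also have "\<dots> = (\<Sum>T\<in>?S. (?e T H)\<^sup>2) + (\<Sum>T\<in>?S. (?e T (G - H))\<^sup>2)"
      by (rule sum.distrib)
    also have "\<dots> \<le> ?B + ?B"
      using H G by (intro add_mono sum_roots_esym_square_le k) auto
    finally show ?thesis by linarith
  qed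
  have "2 ^ card G * (\<Sum>T\<in>?S. \<bar>esym (char_of_roots T) (2 * k) G\<bar>)
        \<le> (\<Sum>T\<in>?S. 4 ^ k * (\<Sum>H\<in>Pow G. \<bar>?e T H\<bar> * \<bar>?e T (G - H)\<bar>))"
    unfolding sum_distrib_left[of "2 ^ card G"] by (intro sum_mono abs_esym_double_le finG)
  also have "\<dots> = 4 ^ k * (\<Sum>H\<in>Pow G. \<Sum>T\<in>?S. \<bar>?e T H\<bar> * \<bar>?e T (G - H)\<bar>)"
    by (simp only: sum_distrib_left[symmetric] sum.swap[of _ ?S])
  also have "\<dots> \<le> 4 ^ k * (\<Sum>H\<in>Pow G. ?B)"
    by (intro mult_left_mono sum_mono pair) auto
  also have "\<dots> = 2 ^ card G * int (4 ^ k * (q ^ t * (q choose k)))"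
    using finG by (simp add: card_Pow)
  finally show ?thesis by simp
qed

text \<open>The expansion of e_m leaves e_2k on the complement of a set W. As W ranges independently
  of T and its product of weights is at most 1 in absolute value, the first-moment bound applies for
  each W. The factor \<open>m choose (2 * k)\<close> is kept because it compensates most of the
  factorials later.\<close>

lemma pair_sum_bound:
  assumes t: "2 * k \<le> t" and m: "2 * k \<le> m"
  shows "int (m choose (2 * k)) * \<bar>pair_sum t m\<bar> \<le>
         int ((q choose (m - 2 * k)) * (4 ^ k * (q ^ t * (q choose k))))"
proof -
  let ?C = "carrier R" and ?B = "int (4 ^ k * (q ^ t * (q choose k)))"
  let ?S = "subsets_of_card ?C t" and ?W = "subsets_of_card ?C (m - 2 * k)"
  let ?e = "\<lambda>T W. esym (char_of_roots T) (2 * k) (?C - W)"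
  have "int (m choose (2 * k)) * \<bar>pair_sum t m\<bar> \<le>
        int (m choose (2 * k)) * (\<Sum>T\<in>?S. \<bar>esym (char_of_roots T) m ?C\<bar>)"
    unfolding pair_sum_def by (intro mult_left_mono sum_abs) auto
  also have "\<dots> = (\<Sum>T\<in>?S. \<bar>int (m choose (2 * k)) * esym (char_of_roots T) m ?C\<bar>)"
    by (simp add: sum_distrib_left abs_mult)
  also have "\<dots> = (\<Sum>T\<in>?S. \<bar>\<Sum>W\<in>?W. prod (char_of_roots T) W * ?e T W\<bar>)"
    by (simp only: esym_expand[OF fin m])
  also have "\<dots> \<le> (\<Sum>T\<in>?S. \<Sum>W\<in>?W. \<bar>prod (char_of_roots T) W * ?e T W\<bar>)"
    by (intro sum_mono sum_abs)
  also have "\<dots> \<le> (\<Sum>T\<in>?S. \<Sum>W\<in>?W. \<bar>?e T W\<bar>)"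
  proof (intro sum_mono)
    fix T W
    show "\<bar>prod (char_of_roots T) W * ?e T W\<bar> \<le> \<bar>?e T W\<bar>"
      unfolding abs_mult
      using mult_right_mono[OF abs_prod_le_1[of "char_of_roots T" W], of "\<bar>?e T W\<bar>"]
        abs_char_of_roots_le_1 by simp
  qed
  also have "\<dots> = (\<Sum>W\<in>?W. \<Sum>T\<in>?S. \<bar>?e T W\<bar>)" by (rule sum.swap)
  also have "\<dots> \<le> (\<Sum>W\<in>?W. ?B)"
    by (intro sum_mono sum_roots_abs_esym_double_le t) auto
  also have "\<dots> = int ((q choose (m - 2 * k)) * (4 ^ k * (q ^ t * (q choose k))))"
    using fin by (simp add: card_subsets_of_card q_def)
  finally show ?thesis .
qed

section \<open>Expansion of the counting problem into bipartite sums\<close>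

text \<open>The two orders of an unordered pair contribute
  \<open>\<eta> (a \<ominus> b) * \<eta> (b \<ominus> a)\<close>, which is
  \<open>\<eta> (\<ominus> \<one>)\<close> times a square of a sign.\<close>

lemma prod_quad_char_pairs:
  assumes "finite T" "T \<subseteq> carrier R"
  shows "(\<Prod>a\<in>T. \<Prod>b\<in>T - {a}. \<eta> (a \<ominus> b)) = \<eta> (\<ominus> \<one>) ^ (card T choose 2)"
  using assms
proof (induction T rule: finite_induct)
  case (insert x T)
  have "(\<Prod>a\<in>insert x T. \<Prod>b\<in>insert x T - {a}. \<eta> (a \<ominus> b)) =
        (\<Prod>b\<in>T. \<eta> (x \<ominus> b)) * (\<Prod>a\<in>T. \<Prod>b\<in>insert x T - {a}. \<eta> (a \<ominus> b))"
    using insert.hyps by simp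
  also have "(\<Prod>a\<in>T. \<Prod>b\<in>insert x T - {a}. \<eta> (a \<ominus> b)) =
      (\<Prod>a\<in>T. \<eta> (a \<ominus> x) * (\<Prod>b\<in>T - {a}. \<eta> (a \<ominus> b)))"
  proof (rule prod.cong[OF refl])
    fix a assume "a \<in> T"
    then have "insert x T - {a} = insert x (T - {a})" using insert.hyps by auto
    then show "(\<Prod>b\<in>insert x T - {a}. \<eta> (a \<ominus> b)) = \<eta> (a \<ominus> x) * (\<Prod>b\<in>T - {a}. \<eta> (a \<ominus> b))"
      using insert.hyps by simp
  qed
  also have "\<dots> = (\<Prod>a\<in>T. \<eta> (a \<ominus> x)) * \<eta> (\<ominus> \<one>) ^ (card T choose 2)"
    using insert by (simp add: prod.distrib)
  also have "(\<Prod>b\<in>T. \<eta> (x \<ominus> b)) * ((\<Prod>a\<in>T. \<eta> (a \<ominus> x)) * \<eta> (\<ominus> \<one>) ^ (card T choose 2)) =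
      (\<Prod>b\<in>T. \<eta> (x \<ominus> b) * \<eta> (b \<ominus> x)) * \<eta> (\<ominus> \<one>) ^ (card T choose 2)"
    by (simp add: prod.distrib)
  also have "(\<Prod>b\<in>T. \<eta> (x \<ominus> b) * \<eta> (b \<ominus> x)) = (\<Prod>b\<in>T. \<eta> (\<ominus> \<one>))"
  proof (rule prod.cong[OF refl])
    fix b assume b: "b \<in> T"
    then have "b \<ominus> x \<noteq> \<zero>" using insert by auto
    then have "\<eta> (b \<ominus> x) * \<eta> (b \<ominus> x) = 1" using quad_char_nonzero by force
    moreover have "\<eta> (x \<ominus> b) = \<eta> (\<ominus> \<one>) * \<eta> (b \<ominus> x)"
      using b insert.prems by (intro quad_char_diff_commute) auto
    ultimately show "\<eta> (x \<ominus> b) * \<eta> (b \<ominus> x) = \<eta> (\<ominus> \<one>)" by (simp add: mult.assoc)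
  qed
  finally show ?case
    using insert.hyps by (simp add: power_add[symmetric] numeral_2_eq_2 add.commute)
qed (simp add: numeral_2_eq_2)

lemma quad_char_Delta:
  assumes S: "S \<subseteq> carrier R" and a: "a \<in> S"
  shows "\<eta> (Delta R S a) = (\<Prod>b\<in>S - {a}. \<eta> (a \<ominus> b))"
proof -
  have "finite S" using S fin finite_subset by blast
  moreover have "(\<lambda>b. a \<ominus> b) \<in> S - {a} \<rightarrow> carrier R" using S a by auto
  ultimately show ?thesis unfolding Delta_def by (intro quad_char_finprod) auto
qed

lemma quad_char_Delta_cases:
  assumes S: "S \<subseteq> carrier R" and a: "a \<in> S"
  shows "\<eta> (Delta R S a) = 1 \<or> \<eta> (Delta R S a) = - 1"
proof -
  have "finite S" using S fin finite_subset by blast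
  have "\<eta> (a \<ominus> b) \<noteq> 0" if "b \<in> S - {a}" for b
  proof -
    have "a \<in> carrier R" "b \<in> carrier R" "a \<noteq> b" using that S a by auto
    then show ?thesis by (simp add: quad_char_eq_0_iff)
  qed
  then have "\<eta> (Delta R S a) \<noteq> 0"
    unfolding quad_char_Delta[OF S a] using \<open>finite S\<close> by simp
  then show ?thesis by (metis quad_char_nonzero quad_char_zero)
qed

lemma Delta_closed: "S \<subseteq> carrier R \<Longrightarrow> a \<in> S \<Longrightarrow> Delta R S a \<in> carrier R"
  unfolding Delta_def by (intro finprod_closed) auto

text \<open>For a in T the other points of S lie in T or in S - T. The inner pairs give a pure sign,
  so the dependence on S and T sits in the bipartite factor.\<close>

lemma prod_quad_char_Delta:
  assumes S: "S \<subseteq> carrier R" and T: "T \<subseteq> S"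
  shows "(\<Prod>a\<in>T. \<eta> (Delta R S a)) = \<eta> (\<ominus> \<one>) ^ (card T choose 2) * prod (char_of_roots (S - T)) T"
proof -
  have finS: "finite S" using S fin finite_subset by blast
  then have finT: "finite T" using T finite_subset by blast
  have "(\<Prod>a\<in>T. \<eta> (Delta R S a)) = (\<Prod>a\<in>T. (\<Prod>b\<in>T - {a}. \<eta> (a \<ominus> b)) * char_of_roots (S - T) a)"
  proof (rule prod.cong[OF refl])
    fix a assume a: "a \<in> T"
    have "S - {a} = (T - {a}) \<union> (S - T)" using a T by auto
    then have "(\<Prod>b\<in>S - {a}. \<eta> (a \<ominus> b)) = (\<Prod>b\<in>T - {a}. \<eta> (a \<ominus> b)) * (\<Prod>b\<in>S - T. \<eta> (a \<ominus> b))"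
      using finS finT by (simp only:) (rule prod.union_disjoint, auto)
    then show "\<eta> (Delta R S a) = (\<Prod>b\<in>T - {a}. \<eta> (a \<ominus> b)) * char_of_roots (S - T) a"
      using quad_char_Delta[OF S, of a] a T by (auto simp: char_of_roots_def)
  qed
  also have "\<dots> = \<eta> (\<ominus> \<one>) ^ (card T choose 2) * prod (char_of_roots (S - T)) T"
    using S T finT by (simp add: prod.distrib prod_quad_char_pairs)
  finally show ?thesis .
qed

definition uniform_sets :: "int \<Rightarrow> nat \<Rightarrow> 'a set set" where
  "uniform_sets \<sigma> n = {S \<in> subsets_of_card (carrier R) n. \<forall>a\<in>S. \<eta> (Delta R S a) = \<sigma>}"

text \<open>The product of the values over all of S is computed in two ways, taking T = S in the
  pair formula. This parity obstruction yields part (a).\<close>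

lemma uniform_sets_sign:
  assumes "S \<in> uniform_sets \<sigma> n"
  shows "\<sigma> ^ n = \<eta> (\<ominus> \<one>) ^ (n choose 2)"
proof -
  have S: "S \<subseteq> carrier R" "card S = n" "\<And>a. a \<in> S \<Longrightarrow> \<eta> (Delta R S a) = \<sigma>"
    using assms by (auto simp: uniform_sets_def subsets_of_card_def)
  have "(\<Prod>a\<in>S. \<eta> (Delta R S a)) = \<sigma> ^ n" using S by simp
  moreover have "(\<Prod>a\<in>S. \<eta> (Delta R S a)) = \<eta> (\<ominus> \<one>) ^ (n choose 2)"
    using prod_quad_char_Delta[OF S(1) order_refl] S(2) by (simp add: char_of_roots_def)
  ultimately show ?thesis by simp
qed

text \<open>A set meeting W contains a root, so its product vanishes.\<close>

lemma esym_char_of_roots_avoid: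
  assumes W: "W \<subseteq> carrier R"
  shows "esym (char_of_roots W) t (carrier R - W) = esym (char_of_roots W) t (carrier R)"
  unfolding esym_def
proof (rule sum.mono_neutral_left)
  show "finite (subsets_of_card (carrier R) t)" using fin by simp
  show "subsets_of_card (carrier R - W) t \<subseteq> subsets_of_card (carrier R) t"
    by (auto simp: subsets_of_card_def)
  show "\<forall>T\<in>subsets_of_card (carrier R) t - subsets_of_card (carrier R - W) t. prod (char_of_roots W) T = 0"
  proof
    fix T assume T: "T \<in> subsets_of_card (carrier R) t - subsets_of_card (carrier R - W) t"
    then have "T \<subseteq> carrier R" and "finite T"
      using fin by (auto simp: subsets_of_card_def intro: finite_subset)
    obtain u where u: "u \<in> T" "u \<in> W" using T by (auto simp: subsets_of_card_def)
    have "finite W" using W fin finite_subset by blast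
    moreover have "\<eta> (u \<ominus> u) = 0" using u W by (auto simp: quad_char_eq_0_iff)
    ultimately have "char_of_roots W u = 0"
      unfolding char_of_roots_def using u by (metis prod_zero)
    then show "prod (char_of_roots W) T = 0"
      using u \<open>finite T\<close> by (metis prod_zero)
  qed
qed

lemma card_uniform_sets_expand:
  assumes \<sigma>: "\<sigma> = 1 \<or> \<sigma> = - 1"
  shows "2 ^ n * int (card (uniform_sets \<sigma> n)) =
         (\<Sum>t\<le>n. \<sigma> ^ t * \<eta> (\<ominus> \<one>) ^ (t choose 2) * pair_sum (n - t) t)"
proof -
  let ?C = "carrier R" and ?S = "subsets_of_card (carrier R) n" and ?\<epsilon> = "\<eta> (\<ominus> \<one>)"
  have "2 ^ n * int (card (uniform_sets \<sigma> n)) = (\<Sum>S\<in>?S. if \<forall>a\<in>S. \<eta> (Delta R S a) = \<sigma> then 2 ^ n else 0)"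
  proof -
    have "(\<Sum>S\<in>?S. if \<forall>a\<in>S. \<eta> (Delta R S a) = \<sigma> then 2 ^ n else 0) = (\<Sum>S\<in>uniform_sets \<sigma> n. 2 ^ n :: int)"
      unfolding uniform_sets_def using fin by (subst sum.inter_filter) auto
    then show ?thesis by simp
  qed
  \<comment> \<open>Both quantities are signs, so each factor is 2 or 0 according to whether the
    value at a equals \<open>\<sigma>\<close>; the power of 2 clears the denominators of the
    indicator.\<close>
  also have "\<dots> = (\<Sum>S\<in>?S. \<Prod>a\<in>S. \<sigma> * \<eta> (Delta R S a) + 1)"
  proof (rule sum.cong[OF refl])
    fix S assume "S \<in> ?S"
    then have S: "S \<subseteq> ?C" "card S = n" "finite S"
      using fin by (auto simp: subsets_of_card_def intro: finite_subset)
    show "(if \<forall>a\<in>S. \<eta> (Delta R S a) = \<sigma> then 2 ^ n else 0) = (\<Prod>a\<in>S. \<sigma> * \<eta> (Delta R S a) + 1)"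
    proof (cases "\<forall>a\<in>S. \<eta> (Delta R S a) = \<sigma>")
      case True
      have "\<sigma> * \<sigma> = 1" using \<sigma> by auto
      then have "(\<Prod>a\<in>S. \<sigma> * \<eta> (Delta R S a) + 1) = (\<Prod>a\<in>S. 2)"
        using True by (intro prod.cong) auto
      then show ?thesis using True S by simp
    next
      case False
      then obtain a where a: "a \<in> S" "\<eta> (Delta R S a) \<noteq> \<sigma>" by auto
      then have "\<sigma> * \<eta> (Delta R S a) + 1 = 0"
        using quad_char_Delta_cases[OF S(1) a(1)] \<sigma> by auto
      then have "(\<Prod>a\<in>S. \<sigma> * \<eta> (Delta R S a) + 1) = 0"
        using a S(3) by (metis (no_types, lifting) prod_zero)
      then show ?thesis using False by auto
    qed
  qed
  also have "\<dots> = (\<Sum>S\<in>?S. \<Sum>t\<le>n. \<Sum>T\<in>subsets_of_card S t.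
       \<sigma> ^ t * ?\<epsilon> ^ (t choose 2) * prod (char_of_roots (S - T)) T)"
  proof (rule sum.cong[OF refl])
    fix S assume "S \<in> ?S"
    then have S: "S \<subseteq> ?C" "card S = n" "finite S"
      using fin by (auto simp: subsets_of_card_def intro: finite_subset)
    have "(\<Prod>a\<in>S. \<sigma> * \<eta> (Delta R S a) + 1) = (\<Sum>T\<in>Pow S. \<Prod>a\<in>T. \<sigma> * \<eta> (Delta R S a))"
      using prod_add[OF S(3), of "\<lambda>a. \<sigma> * \<eta> (Delta R S a)" "\<lambda>_. 1"] by simp
    also have "\<dots> = (\<Sum>t\<le>n. \<Sum>T\<in>{T \<in> Pow S. card T = t}. \<Prod>a\<in>T. \<sigma> * \<eta> (Delta R S a))"
      by (rule sum.group[symmetric]) (use S in \<open>auto intro: card_mono\<close>)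
    also have "\<dots> = (\<Sum>t\<le>n. \<Sum>T\<in>subsets_of_card S t.
       \<sigma> ^ t * ?\<epsilon> ^ (t choose 2) * prod (char_of_roots (S - T)) T)"
      by (intro sum.cong refl)
         (auto simp: subsets_of_card_def prod.distrib prod_quad_char_Delta[OF S(1)] mult.assoc)
    finally show "(\<Prod>a\<in>S. \<sigma> * \<eta> (Delta R S a) + 1) = (\<Sum>t\<le>n. \<Sum>T\<in>subsets_of_card S t.
       \<sigma> ^ t * ?\<epsilon> ^ (t choose 2) * prod (char_of_roots (S - T)) T)" .
  qed
  also have "\<dots> = (\<Sum>t\<le>n. \<Sum>S\<in>?S. \<Sum>T\<in>subsets_of_card S t.
       \<sigma> ^ t * ?\<epsilon> ^ (t choose 2) * prod (char_of_roots (S - T)) T)"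
    by (rule sum.swap)
  also have "\<dots> = (\<Sum>t\<le>n. \<sigma> ^ t * ?\<epsilon> ^ (t choose 2) * pair_sum (n - t) t)"
  proof (rule sum.cong[OF refl])
    fix t assume "t \<in> {..n}"
    then have t: "t \<le> n" by simp
    \<comment> \<open>Here T becomes the set of evaluation points and W = S - T the root set, hence
      the order of the indices in \<open>pair_sum (n - t) t\<close>.\<close>
    have "(\<Sum>S\<in>?S. \<Sum>T\<in>subsets_of_card S t. prod (char_of_roots (S - T)) T) =
          (\<Sum>W\<in>subsets_of_card ?C (n - t). esym (char_of_roots W) t (?C - W))"
      unfolding esym_def by (rule sum_pairs_subset_eq_disjoint[OF fin t, of "\<lambda>W T. prod (char_of_roots W) T"])
    also have "\<dots> = pair_sum (n - t) t"
      unfolding pair_sum_def by (intro sum.cong refl esym_char_of_roots_avoid) (rule subsets_of_cardD(1))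
    finally show "(\<Sum>S\<in>?S. \<Sum>T\<in>subsets_of_card S t.
       \<sigma> ^ t * ?\<epsilon> ^ (t choose 2) * prod (char_of_roots (S - T)) T) =
       \<sigma> ^ t * ?\<epsilon> ^ (t choose 2) * pair_sum (n - t) t"
      by (simp add: sum_distrib_left[symmetric])
  qed
  finally show ?thesis .
qed

lemma pair_sum_0_left: "pair_sum 0 n = int (q choose n)"
  using fin by (simp add: pair_sum_def subsets_of_card_0 esym_def char_of_roots_def card_subsets_of_card q_def)

lemma pair_sum_0_right: "pair_sum n 0 = int (q choose n)"
  using fin by (simp add: pair_sum_def subsets_of_card_0 esym_def card_subsets_of_card q_def)

text \<open>The terms t = 0 and t = n each have absolute value \<open>q choose n\<close>; the sign
  hypothesis makes them add up instead of cancelling.\<close>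

lemma card_uniform_sets_error:
  assumes \<sigma>: "\<sigma> = 1 \<or> \<sigma> = - 1" and n: "n \<ge> 1" and sign: "\<sigma> ^ n * \<eta> (\<ominus> \<one>) ^ (n choose 2) = 1"
  shows "\<bar>2 ^ n * int (card (uniform_sets \<sigma> n)) - 2 * int (q choose n)\<bar> \<le> (\<Sum>t\<in>{1..<n}. \<bar>pair_sum (n - t) t\<bar>)"
proof -
  let ?f = "\<lambda>t. \<sigma> ^ t * \<eta> (\<ominus> \<one>) ^ (t choose 2) * pair_sum (n - t) t"
  have "{..n} = insert 0 (insert n {1..<n})" using n by auto
  then have "(\<Sum>t\<le>n. ?f t) = ?f 0 + (?f n + (\<Sum>t\<in>{1..<n}. ?f t))"
    using n by (simp del: One_nat_def)
  moreover have "?f 0 = int (q choose n)"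
    by (simp add: pair_sum_0_right numeral_2_eq_2)
  moreover have "?f n = int (q choose n)"
    unfolding sign by (simp add: pair_sum_0_left)
  ultimately have "2 ^ n * int (card (uniform_sets \<sigma> n)) - 2 * int (q choose n) = (\<Sum>t\<in>{1..<n}. ?f t)"
    unfolding card_uniform_sets_expand[OF \<sigma>] by simp
  moreover have "\<bar>\<Sum>t\<in>{1..<n}. ?f t\<bar> \<le> (\<Sum>t\<in>{1..<n}. \<bar>?f t\<bar>)" by (rule sum_abs)
  moreover have "\<bar>?f t\<bar> = \<bar>pair_sum (n - t) t\<bar>" for t
    using \<sigma> quad_char_minus_one_cases by (auto simp: abs_mult power_abs)
  ultimately show ?thesis by simp
qed

text \<open>The common value is a sign, which an element of S determines; for n = 0 the empty set
  would be counted under both signs.\<close>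

lemma Omega_eq_uniform_sets:
  assumes "n \<ge> 1"
  shows "Omega R n = uniform_sets 1 n \<union> uniform_sets (- 1) n" "uniform_sets 1 n \<inter> uniform_sets (- 1) n = {}"
proof -
  show "uniform_sets 1 n \<inter> uniform_sets (- 1) n = {}"
  proof (rule equals0I)
    fix S assume S: "S \<in> uniform_sets 1 n \<inter> uniform_sets (- 1) n"
    then have "card S = n" by (simp add: uniform_sets_def subsets_of_card_def)
    with assms obtain a where "a \<in> S" by fastforce
    with S have "\<eta> (Delta R S a) = 1" "\<eta> (Delta R S a) = - 1"
      by (auto simp: uniform_sets_def)
    then show False by simp
  qed
  show "Omega R n = uniform_sets 1 n \<union> uniform_sets (- 1) n"
  proof (intro equalityI subsetI)
    fix S assume "S \<in> Omega R n"
    then have S: "S \<subseteq> carrier R" "card S = n"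
      and eq: "\<And>a b. a \<in> S \<Longrightarrow> b \<in> S \<Longrightarrow> \<eta> (Delta R S a) = \<eta> (Delta R S b)"
      unfolding Omega_def by blast+
    from S assms obtain a where a: "a \<in> S" by fastforce
    have "\<forall>b\<in>S. \<eta> (Delta R S b) = \<eta> (Delta R S a)" using eq a by blast
    then show "S \<in> uniform_sets 1 n \<union> uniform_sets (- 1) n"
      using quad_char_Delta_cases[OF S(1) a] S by (auto simp: uniform_sets_def subsets_of_card_def)
  next
    fix S assume "S \<in> uniform_sets 1 n \<union> uniform_sets (- 1) n"
    then show "S \<in> Omega R n"
      using fin by (auto simp: uniform_sets_def subsets_of_card_def Omega_def intro: finite_subset)
  qed
qed

text \<open>Pulling out the minus sign multiplies the character by
  \<open>\<eta> (\<ominus> \<one>)\<close>, so the condition prescribes this one sign as the common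
  value.\<close>

lemma Omega_tilde_eq_uniform_sets: "Omega_tilde R (n + 1) = uniform_sets (\<eta> (\<ominus> \<one>)) n"
proof -
  have "\<eta> (\<ominus> Delta R S a) = 1 \<longleftrightarrow> \<eta> (Delta R S a) = \<eta> (\<ominus> \<one>)" if "S \<subseteq> carrier R" "a \<in> S" for S a
    using quad_char_minus[OF Delta_closed[OF that]] quad_char_Delta_cases[OF that] quad_char_minus_one_cases
    by auto
  then show ?thesis
    using fin by (auto simp: uniform_sets_def subsets_of_card_def Omega_tilde_def intro: finite_subset)
qed


section \<open>Bounds relative to the main term\<close>

text \<open>With n = m + 1, the bound q^m / (m-1)! is at most n^2/q times q^n / n!. The weaker n^4
  and the constant 8 are chosen to match the bound for t = 2 and t = 3.\<close>

lemma pair_sum_1_rel_bound: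
  assumes m: "1 \<le> m" and q: "4 * (m + 1) ^ 4 \<le> q"
  shows "\<bar>real_of_int (pair_sum 1 m)\<bar> \<le> 8 * (real (m + 1) ^ 4 / real q) * real (q choose (m + 1))"
proof -
  define n where "n = m + 1"
  have q0: "real q > 0" using q_ge_3 by simp
  have "n\<^sup>2 \<le> n ^ 4" unfolding n_def by (intro power_increasing) auto
  then have small: "2 * n\<^sup>2 \<le> q" using q unfolding n_def by linarith
  have "\<bar>real_of_int (pair_sum 1 m)\<bar> \<le> real (q * (q choose (m - 1)))"
    using abs_pair_sum_1_le[OF m] by linarith
  also have "\<dots> \<le> real q * (real q ^ (m - 1) / fact (m - 1))"
    unfolding of_nat_mult by (intro mult_left_mono real_binomial_le_pow_div_fact) simp
  also have "\<dots> = real q ^ m / fact (m - 1)"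
    using m by (simp add: power_eq_if)
  also have "\<dots> \<le> real q ^ m * (real n ^ 2 / fact n)"
  proof -
    have "(fact n :: real) \<le> real n ^ 2 * fact (m - 1)"
      using fact_le_pow_mult_fact[of "m - 1" 2] m by (simp add: n_def)
    then have "1 / fact (m - 1) \<le> real n ^ 2 / fact n" by (simp add: field_simps)
    from mult_left_mono[OF this, of "real q ^ m"] show ?thesis by simp
  qed
  also have "\<dots> = real n ^ 2 / real q * (real q ^ n / fact n)"
    using q0 by (simp add: n_def)
  also have "\<dots> \<le> real n ^ 2 / real q * (2 * real (q choose n))"
    using pow_div_fact_le_binomial[OF small] by (intro mult_left_mono) auto
  also have "\<dots> = (2 * real n ^ 2) / real q * real (q choose n)" by simp
  also have "\<dots> \<le> (8 * real n ^ 4) / real q * real (q choose n)"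
  proof (intro mult_right_mono divide_right_mono)
    have "real n ^ 2 \<le> real n ^ 4" unfolding n_def by (intro power_increasing) auto
    moreover have "0 \<le> real n ^ 4" by simp
    ultimately show "2 * real n ^ 2 \<le> 8 * real n ^ 4" by linarith
  qed auto
  finally show ?thesis by (simp add: n_def)
qed

text \<open>In the base n^3, two powers of n per k come from n!/m!, which is at most n^t, and one
  from (2k)!/k!. The single extra n covers odd t, and the 2 is the price of replacing q^n/n! by the
  binomial coefficient.\<close>

lemma pair_sum_rel_bound_pow:
  assumes k: "t = 2 * k \<or> t = 2 * k + 1" and k1: "1 \<le> k" and tm: "t \<le> m"
    and n: "n = t + m" and q: "2 * n\<^sup>2 \<le> q"
  shows "\<bar>real_of_int (pair_sum t m)\<bar> \<le> 2 * real n * (4 * real n ^ 3 / real q) ^ k * real (q choose n)"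
proof -
  let ?P = "\<bar>real_of_int (pair_sum t m)\<bar>"
  have q0: "real q > 0" using q_ge_3 by simp
  have km: "2 * k \<le> t" "2 * k \<le> m" using k tm by auto
  have "real_of_int (int (m choose (2 * k)) * \<bar>pair_sum t m\<bar>) \<le>
        real_of_int (int ((q choose (m - 2 * k)) * (4 ^ k * (q ^ t * (q choose k)))))"
    by (subst of_int_le_iff) (rule pair_sum_bound[OF km])
  then have "real (m choose (2 * k)) * ?P \<le> real (q choose (m - 2 * k)) * (4 ^ k * (real q ^ t * real (q choose k)))"
    by simp
  also have "\<dots> \<le> (real q ^ (m - 2 * k) / fact (m - 2 * k)) * (4 ^ k * (real q ^ t * (real q ^ k / fact k)))"
    by (intro mult_mono mult_left_mono real_binomial_le_pow_div_fact) auto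
  finally have 1: "real (m choose (2 * k)) * ?P \<le>
      (real q ^ (m - 2 * k) / fact (m - 2 * k)) * (4 ^ k * (real q ^ t * (real q ^ k / fact k)))" .
  have c: "real (m choose (2 * k)) = fact m / (fact (2 * k) * fact (m - 2 * k))"
    by (rule binomial_fact[OF km(2)])
  have "fact m * ?P = (fact (2 * k) * fact (m - 2 * k)) * (real (m choose (2 * k)) * ?P)"
    unfolding c by simp
  also have "\<dots> \<le> (fact (2 * k) * fact (m - 2 * k)) *
      ((real q ^ (m - 2 * k) / fact (m - 2 * k)) * (4 ^ k * (real q ^ t * (real q ^ k / fact k))))"
    by (rule mult_left_mono[OF 1]) simp
  also have "\<dots> = (fact (2 * k) / fact k) * 4 ^ k * (real q ^ (m - 2 * k) * real q ^ t * real q ^ k)"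
    by simp
  \<comment> \<open>The exponents add up to n - k: the saving against the trivial bound is
    q^k.\<close>
  also have "real q ^ (m - 2 * k) * real q ^ t * real q ^ k = real q ^ n / real q ^ k"
  proof -
    have "n = ((m - 2 * k) + t + k) + k" using km n by simp
    then have "real q ^ n = real q ^ (m - 2 * k) * real q ^ t * real q ^ k * real q ^ k"
      by (simp only: power_add)
    then show ?thesis using q0 by simp
  qed
  also have "(fact (2 * k) / fact k) * 4 ^ k * (real q ^ n / real q ^ k) \<le>
      real n ^ k * 4 ^ k * (real q ^ n / real q ^ k)"
  proof (intro mult_right_mono)
    have "(fact (2 * k) :: real) \<le> real (2 * k) ^ k * fact k"
      using fact_le_pow_mult_fact[of k k] unfolding mult_2 .
    also have "\<dots> \<le> real n ^ k * fact k"
      using km n by (intro mult_right_mono power_mono) auto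
    finally show "fact (2 * k) / fact k \<le> real n ^ k" by (simp add: field_simps)
  qed auto
  finally have 2: "fact m * ?P \<le> real n ^ k * 4 ^ k * (real q ^ n / real q ^ k)" .
  have "(fact n :: real) \<le> real n ^ t * fact m"
    using fact_le_pow_mult_fact[of m t] by (simp add: n add.commute)
  also have "\<dots> \<le> real n ^ (2 * k + 1) * fact m"
    using k k1 n by (intro mult_right_mono power_increasing) auto
  finally have "fact n * ?P \<le> real n ^ (2 * k + 1) * fact m * ?P"
    by (rule mult_right_mono) simp
  also have "\<dots> = real n ^ (2 * k + 1) * (fact m * ?P)" by simp
  also have "\<dots> \<le> real n ^ (2 * k + 1) * (real n ^ k * 4 ^ k * (real q ^ n / real q ^ k))"
    by (rule mult_left_mono[OF 2]) simp
  also have "\<dots> = real n * (4 * real n ^ 3 / real q) ^ k * real q ^ n"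
  proof -
    have "(4 * real n ^ 3 / real q) ^ k = 4 ^ k * (real n ^ (2 * k) * real n ^ k) / real q ^ k"
      by (simp add: power_divide power_mult_distrib power_mult[symmetric] power_add[symmetric])
    then show ?thesis by simp
  qed
  finally have "?P \<le> real n * (4 * real n ^ 3 / real q) ^ k * (real q ^ n / fact n)"
    unfolding times_divide_eq_right by (subst pos_le_divide_eq) (simp_all only: mult.commute[of ?P] fact_gt_zero)
  also have "\<dots> \<le> real n * (4 * real n ^ 3 / real q) ^ k * (2 * real (q choose n))"
    using pow_div_fact_le_binomial[OF q] by (intro mult_left_mono) auto
  finally show ?thesis by (simp add: mult_ac)
qed

text \<open>With y = 4 n^3 / q the previous bound is 2 n y^k. For k = 1 this is 8 n^4 / q; for k at
  least 2 a further y, at most 1/n, is available, which is what lets about n terms be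
  summed.\<close>

lemma pair_sum_rel_bound_le:
  assumes t: "1 \<le> t" "t \<le> m" and n: "n = t + m" and q: "4 * n ^ 4 \<le> q"
  shows "\<bar>real_of_int (pair_sum t m)\<bar> \<le>
    8 * (real n ^ 4 / real q) * real (q choose n) * (if t < 4 then 1 else 1 / real n)"
proof (cases "t = 1")
  case True
  then show ?thesis using pair_sum_1_rel_bound[of m] t n q by simp
next
  case False
  define k where "k = t div 2"
  define y where "y = 4 * real n ^ 3 / real q"
  have k: "t = 2 * k \<or> t = 2 * k + 1" "1 \<le> k" using t False unfolding k_def by presburger+
  have q0: "real q > 0" using q_ge_3 by simp
  have n1: "n \<ge> 1" using t n by simp
  have "n\<^sup>2 \<le> n ^ 4" using n1 by (intro power_increasing) auto
  then have small: "2 * n\<^sup>2 \<le> q" using q by linarith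
  have y0: "0 \<le> y" using q0 by (simp add: y_def)
  have "real (4 * n ^ 4) \<le> real q" using q by (simp only: of_nat_le_iff)
  then have yn: "y \<le> 1 / real n"
    using n1 q0 by (simp add: y_def field_simps power3_eq_cube power4_eq_xxxx)
  also have "\<dots> \<le> 1" using n1 by simp
  finally have y1: "y \<le> 1" .
  have "y ^ k \<le> y * (if t < 4 then 1 else 1 / real n)"
  proof (cases "t < 4")
    case True
    then show ?thesis using power_decreasing[of 1 k y] y0 y1 k by simp
  next
    case False
    then have "2 \<le> k" unfolding k_def by presburger
    then have "y ^ k \<le> y * y" using power_decreasing[of 2 k y] y0 y1 by (simp add: power2_eq_square)
    also have "\<dots> \<le> y * (1 / real n)" by (rule mult_left_mono[OF yn y0])
    finally show ?thesis using False by simp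
  qed
  then have "2 * real n * y ^ k * real (q choose n) \<le>
    2 * real n * (y * (if t < 4 then 1 else 1 / real n)) * real (q choose n)"
    by (intro mult_right_mono mult_left_mono) auto
  also have "\<dots> = 8 * (real n ^ 4 / real q) * real (q choose n) * (if t < 4 then 1 else 1 / real n)"
    by (simp add: y_def power3_eq_cube power4_eq_xxxx)
  finally show ?thesis
    using pair_sum_rel_bound_pow[OF k t(2) n small] by (simp add: y_def)
qed

lemma sum_pair_sum_rel_bound:
  assumes q: "4 * n ^ 4 \<le> q"
  shows "(\<Sum>t\<in>{1..<n}. \<bar>real_of_int (pair_sum (n - t) t)\<bar>) \<le>
    56 * (real n ^ 4 / real q) * real (q choose n)"
proof -
  let ?X = "8 * (real n ^ 4 / real q) * real (q choose n)"
  have X: "0 \<le> ?X" by simp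
  \<comment> \<open>At most three t lie near each end, and the terms 1/n sum to at most 1. The total
    of 7 times 8 gives the constant 56.\<close>
  let ?g = "\<lambda>t. (if t < 4 then 1 else 0) + (if n - t < 4 then 1 else 0) + 1 / real n"
  have "\<bar>real_of_int (pair_sum (n - t) t)\<bar> \<le> ?X * ?g t" if t: "t \<in> {1..<n}" for t
  proof (cases "t \<le> n - t")
    case True
    have "\<bar>real_of_int (pair_sum (n - t) t)\<bar> = \<bar>real_of_int (pair_sum t (n - t))\<bar>"
      using abs_pair_sum_commute[of "n - t" t] by (metis of_int_abs)
    also have "\<dots> \<le> ?X * (if t < 4 then 1 else 1 / real n)"
      by (rule pair_sum_rel_bound_le) (use t True q in auto)
    also have "\<dots> \<le> ?X * ?g t" by (intro mult_left_mono X) auto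
    finally show ?thesis .
  next
    case False
    have "\<bar>real_of_int (pair_sum (n - t) t)\<bar> \<le> ?X * (if n - t < 4 then 1 else 1 / real n)"
      by (rule pair_sum_rel_bound_le) (use t False q in auto)
    also have "\<dots> \<le> ?X * ?g t" by (intro mult_left_mono X) auto
    finally show ?thesis .
  qed
  then have "(\<Sum>t\<in>{1..<n}. \<bar>real_of_int (pair_sum (n - t) t)\<bar>) \<le> (\<Sum>t\<in>{1..<n}. ?X * ?g t)"
    by (intro sum_mono)
  also have "\<dots> = ?X * (\<Sum>t\<in>{1..<n}. ?g t)" by (rule sum_distrib_left[symmetric])
  also have "\<dots> \<le> ?X * 7"
  proof (intro mult_left_mono X)
    have "card {t \<in> {1..<n}. t < 4} \<le> card {1..<4::nat}" by (intro card_mono) auto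
    then have a: "(\<Sum>t\<in>{1..<n}. if t < 4 then 1 else 0) \<le> (3::real)"
      by (simp add: sum.inter_filter[symmetric])
    have "card {t \<in> {1..<n}. n - t < 4} \<le> card {n - 3..<n}" by (intro card_mono) auto
    then have b: "(\<Sum>t\<in>{1..<n}. if n - t < 4 then 1 else 0) \<le> (3::real)"
      by (simp add: sum.inter_filter[symmetric])
    have c: "(\<Sum>t\<in>{1..<n}. 1 / real n) \<le> 1"
      by (cases "n = 0") (simp_all add: field_simps)
    show "(\<Sum>t\<in>{1..<n}. ?g t) \<le> 7" unfolding sum.distrib using a b c by linarith
  qed
  finally show ?thesis by simp
qed

lemma card_uniform_sets_rel_error:
  assumes \<sigma>: "\<sigma> = 1 \<or> \<sigma> = - 1" and n: "n \<ge> 1" and sign: "\<sigma> ^ n * \<eta> (\<ominus> \<one>) ^ (n choose 2) = 1"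
    and q: "4 * n ^ 4 \<le> q"
  shows "\<bar>real (card (uniform_sets \<sigma> n)) - 2 / 2 ^ n * real (q choose n)\<bar> \<le>
    56 * (real n ^ 4 / real q) * (1 / 2 ^ n * real (q choose n))"
proof -
  have "real_of_int \<bar>2 ^ n * int (card (uniform_sets \<sigma> n)) - 2 * int (q choose n)\<bar> \<le>
    real_of_int (\<Sum>t\<in>{1..<n}. \<bar>pair_sum (n - t) t\<bar>)"
    by (subst of_int_le_iff) (rule card_uniform_sets_error[OF \<sigma> n sign])
  also have "\<dots> \<le> 56 * (real n ^ 4 / real q) * real (q choose n)"
    using sum_pair_sum_rel_bound[OF q] by simp
  finally have "\<bar>2 ^ n * real (card (uniform_sets \<sigma> n)) - 2 * real (q choose n)\<bar> / 2 ^ n \<le>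
      56 * (real n ^ 4 / real q) * real (q choose n) / 2 ^ n"
    by (intro divide_right_mono) simp_all
  moreover have "\<bar>2 ^ n * real (card (uniform_sets \<sigma> n)) - 2 * real (q choose n)\<bar> / 2 ^ n =
     \<bar>(2 ^ n * real (card (uniform_sets \<sigma> n)) - 2 * real (q choose n)) / 2 ^ n\<bar>"
    by simp
  ultimately show ?thesis by (simp add: diff_divide_distrib)
qed


section \<open>Emptiness and explicit relative errors for the two families\<close>

lemma quad_char_minus_one_mod_4:
  "q mod 4 = 1 \<Longrightarrow> \<eta> (\<ominus> \<one>) = 1" "q mod 4 = 3 \<Longrightarrow> \<eta> (\<ominus> \<one>) = - 1"
proof -
  assume "q mod 4 = 1"
  then have "even ((q - 1) div 2)" by presburger
  then show "\<eta> (\<ominus> \<one>) = 1" by (simp add: quad_char_minus_one)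
next
  assume "q mod 4 = 3"
  then have "odd ((q - 1) div 2)" by presburger
  then show "\<eta> (\<ominus> \<one>) = - 1" by (simp add: quad_char_minus_one)
qed

text \<open>An even n makes \<open>\<sigma> ^ n\<close> equal to 1, while \<open>n choose 2\<close>
  is odd and minus one is a nonsquare.\<close>

lemma Omega_eq_empty:
  assumes "q mod 4 = 3" "n mod 4 = 2"
  shows "Omega R n = {}"
proof -
  have n: "n \<ge> 1" "even n" using assms by presburger+
  have "odd (n choose 2)" using assms by (simp add: even_choose_two_iff)
  then have "uniform_sets \<sigma> n = {}" if "\<sigma> = 1 \<or> \<sigma> = - 1" for \<sigma>
    using uniform_sets_sign[of _ \<sigma> n] that n quad_char_minus_one_mod_4 assms by fastforce
  then show ?thesis using Omega_eq_uniform_sets[OF n(1)] by simp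
qed

text \<open>The prescribed sign is -1 and n is odd, so its power is -1, while
  \<open>n choose 2\<close> is even.\<close>

lemma Omega_tilde_eq_empty:
  assumes "q mod 4 = 3" "n mod 4 = 1"
  shows "Omega_tilde R (n + 1) = {}"
proof -
  have "odd n" using assms by presburger
  have "even (n choose 2)" using assms by (simp add: even_choose_two_iff)
  then have "uniform_sets (- 1) n = {}"
    using uniform_sets_sign[of _ "- 1" n] \<open>odd n\<close> quad_char_minus_one_mod_4(2)[OF assms(1)] by fastforce
  then show ?thesis using quad_char_minus_one_mod_4 assms by (simp only: Omega_tilde_eq_uniform_sets)
qed

text \<open>Both signs contribute 2/2^n, so the main term is 4/2^n; the two errors 56/2^n together
  are 28 times 4/2^n.\<close>

lemma card_Omega_rel_error:
  assumes n: "n \<ge> 1" "even n" and "q mod 4 = 1 \<or> q mod 4 = 3 \<and> n mod 4 = 0" and q: "4 * n ^ 4 \<le> q"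
  shows "\<bar>real (card (Omega R n)) - 2 powr (2 - real n) * real (q choose n)\<bar> \<le>
    28 * (real n ^ 4 / real q) * (2 powr (2 - real n) * real (q choose n))"
proof -
  have "\<eta> (\<ominus> \<one>) ^ (n choose 2) = 1"
    using assms(3) quad_char_minus_one_mod_4 by (auto simp: even_choose_two_iff)
  then have u: "\<bar>real (card (uniform_sets \<sigma> n)) - 2 / 2 ^ n * real (q choose n)\<bar> \<le>
    56 * (real n ^ 4 / real q) * (1 / 2 ^ n * real (q choose n))" if "\<sigma> = 1 \<or> \<sigma> = - 1" for \<sigma>
    using that n q by (intro card_uniform_sets_rel_error) auto
  have "finite (uniform_sets \<sigma> n)" for \<sigma>
    using fin by (simp add: uniform_sets_def)
  then have "card (Omega R n) = card (uniform_sets 1 n) + card (uniform_sets (- 1) n)"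
    unfolding Omega_eq_uniform_sets(1)[OF n(1)] using Omega_eq_uniform_sets(2)[OF n(1)]
    by (intro card_Un_disjoint) auto
  moreover have "2 powr (2 - real n) = 4 / 2 ^ n"
    by (simp add: powr_diff powr_realpow)
  ultimately show ?thesis using u[of 1] u[of "- 1"] by simp
qed

lemma card_Omega_tilde_rel_error:
  assumes n: "odd n" and "q mod 4 = 1 \<or> q mod 4 = 3 \<and> n mod 4 = 3" and q: "4 * n ^ 4 \<le> q"
  shows "\<bar>real (card (Omega_tilde R (n + 1))) - 2 powr (1 - real n) * real (q choose n)\<bar> \<le>
    28 * (real n ^ 4 / real q) * (2 powr (1 - real n) * real (q choose n))"
proof -
  \<comment> \<open>If minus one is a nonsquare, n = 3 modulo 4 makes both exponents odd, so the two
    signs cancel.\<close>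
  have "\<eta> (\<ominus> \<one>) ^ n * \<eta> (\<ominus> \<one>) ^ (n choose 2) = 1"
    using assms(1,2) quad_char_minus_one_mod_4 by (auto simp: even_choose_two_iff)
  moreover have "n \<ge> 1" using n by (auto intro: Suc_leI odd_pos)
  ultimately have "\<bar>real (card (uniform_sets (\<eta> (\<ominus> \<one>)) n)) - 2 / 2 ^ n * real (q choose n)\<bar> \<le>
    56 * (real n ^ 4 / real q) * (1 / 2 ^ n * real (q choose n))"
    using q quad_char_minus_one_cases by (intro card_uniform_sets_rel_error) auto
  moreover have "2 powr (1 - real n) = 2 / 2 ^ n"
    by (simp add: powr_diff powr_realpow)
  ultimately show ?thesis by (simp add: Omega_tilde_eq_uniform_sets[simplified])
qed

end

section \<open>Passage to the limit\<close>

text \<open>The relative error 28 n^4 / q is 28 times the fourth power of the ratio assumed to tend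
  to 0. The same convergence eventually makes n^4 / q smaller than 1/4, which provides the size
  condition. The function h stands for the power of 2, which differs between the two
  families.\<close>

lemma asymp_equiv_q_at_topI:
  fixes n :: "nat \<Rightarrow> nat" and f :: "nat \<Rightarrow> real" and h :: "real \<Rightarrow> real"
  assumes lim: "filterlim n at_top (q_at_top P)" "((\<lambda>q. real (n q) / real q powr (1 / 4)) \<longlongrightarrow> 0) (q_at_top P)"
    and h: "\<And>x. h x > 0"
    and err: "\<And>q. odd_prime_power q \<Longrightarrow> P q \<Longrightarrow> n q \<ge> 1 \<Longrightarrow> 4 * n q ^ 4 \<le> q \<Longrightarrow>
      \<bar>f q - h (real (n q)) * real (q choose n q)\<bar> \<le>
        28 * (real (n q) ^ 4 / real q) * (h (real (n q)) * real (q choose n q))"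
  shows "f \<sim>[q_at_top P] (\<lambda>q. h (real (n q)) * real (q choose n q))"
proof -
  let ?F = "q_at_top P" and ?r = "\<lambda>q. real (n q) / real q powr (1 / 4)"
  have r4: "?r q ^ 4 = real (n q) ^ 4 / real q" if "q > 0" for q
  proof -
    have "(real q powr (1 / 4)) ^ 4 = (real q powr (1 / 4)) powr real 4"
      by (rule powr_realpow[symmetric]) (use that in simp)
    also have "\<dots> = real q" using that by (simp add: powr_powr)
    finally show ?thesis using that by (simp add: power_divide)
  qed
  have opp: "eventually (\<lambda>q. odd_prime_power q \<and> P q \<and> q > 0) ?F"
    by (rule eventually_q_at_topI) (auto simp: odd_prime_power_def intro: odd_pos)
  have n1: "eventually (\<lambda>q. n q \<ge> 1) ?F"
    using lim(1) by (auto simp: filterlim_at_top)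
  have "((\<lambda>q. ?r q ^ 4) \<longlongrightarrow> 0 ^ 4) ?F" by (intro tendsto_power lim(2))
  then have r0: "((\<lambda>q. ?r q ^ 4) \<longlongrightarrow> 0) ?F" by simp
  then have "eventually (\<lambda>q. ?r q ^ 4 < 1 / 4) ?F" by (rule order_tendstoD) simp
  with opp have small: "eventually (\<lambda>q. 4 * n q ^ 4 \<le> q) ?F"
  proof eventually_elim
    case (elim q)
    then have "real (n q) ^ 4 / real q < 1 / 4" using r4[of q] by metis
    then have "4 * real (n q) ^ 4 < real q" using elim by (simp add: pos_divide_less_eq)
    then have "real (4 * n q ^ 4) < real q" by simp
    then show ?case by (simp only: of_nat_less_iff)
  qed
  show ?thesis
  proof (rule asymp_equivI_rel_error)
    show "((\<lambda>q. 28 * ?r q ^ 4) \<longlongrightarrow> 0) ?F" by (rule tendsto_mult_right_zero[OF r0])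
    show "eventually (\<lambda>q. \<bar>f q - h (real (n q)) * real (q choose n q)\<bar> \<le>
        28 * ?r q ^ 4 * (h (real (n q)) * real (q choose n q))) ?F"
      using opp n1 small
    proof eventually_elim
      case (elim q)
      then show ?case using err[of q] r4[of q] by simp
    qed
    show "eventually (\<lambda>q. 0 < h (real (n q)) * real (q choose n q)) ?F"
      using n1 small
    proof eventually_elim
      case (elim q)
      \<comment> \<open>This gives n at most q, so the binomial coefficient is positive.\<close>
      have "n q ^ 1 \<le> n q ^ 4" by (rule power_increasing) (use elim in auto)
      then have "n q \<le> q" using elim by simp
      then show ?case using h by simp
    qed
  qed
qed

theorem theorem6p3:
  fixes F :: "nat \<Rightarrow> ('a, 'b) ring_scheme"
  assumes F: "\<And>q. odd_prime_power q \<Longrightarrow> field (F q) \<and> card (carrier (F q)) = q"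
  shows
    "(\<forall>q. odd_prime_power q \<and> [q = 3] (mod 4) \<longrightarrow>
        (\<forall>n. [n = 2] (mod 4) \<longrightarrow> Omega (F q) n = {}) \<and>
        (\<forall>n. [n = 1] (mod 4) \<longrightarrow> Omega_tilde (F q) (n + 1) = {}))
     \<and>
     (\<forall>n :: nat \<Rightarrow> nat.
        filterlim n at_top (q_at_top (\<lambda>q. [q = 3] (mod 4))) \<and>
        ((\<lambda>q. real (n q) / real q powr (1 / 4)) \<longlongrightarrow> 0) (q_at_top (\<lambda>q. [q = 3] (mod 4))) \<longrightarrow>
        (\<lambda>q. real (card (Omega (F q) (n q))))
          \<sim>[q_at_top (\<lambda>q. [q = 3] (mod 4) \<and> [n q = 0] (mod 4))]
          (\<lambda>q. 2 powr (2 - real (n q)) * real (q choose n q)) \<and>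
        (\<lambda>q. real (card (Omega_tilde (F q) (n q + 1))))
          \<sim>[q_at_top (\<lambda>q. [q = 3] (mod 4) \<and> [n q = 3] (mod 4))]
          (\<lambda>q. 2 powr (1 - real (n q)) * real (q choose n q)))
     \<and>
     (\<forall>n :: nat \<Rightarrow> nat.
        filterlim n at_top (q_at_top (\<lambda>q. [q = 1] (mod 4))) \<and>
        ((\<lambda>q. real (n q) / real q powr (1 / 4)) \<longlongrightarrow> 0) (q_at_top (\<lambda>q. [q = 1] (mod 4))) \<longrightarrow>
        (\<lambda>q. real (card (Omega (F q) (n q))))
          \<sim>[q_at_top (\<lambda>q. [q = 1] (mod 4) \<and> even (n q))]
          (\<lambda>q. 2 powr (2 - real (n q)) * real (q choose n q)) \<and>
        (\<lambda>q. real (card (Omega_tilde (F q) (n q + 1))))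
          \<sim>[q_at_top (\<lambda>q. [q = 1] (mod 4) \<and> odd (n q))]
          (\<lambda>q. 2 powr (1 - real (n q)) * real (q choose n q)))"
proof (intro conjI allI impI; (elim conjE)?)
  have loc: "odd_finite_field (F q)" and card: "odd_finite_field.q (F q) = q" if "odd_prime_power q" for q
  proof -
    \<comment> \<open>An infinite carrier would have cardinality 0, so a positive cardinality gives
      finiteness.\<close>
    have "q > 0" "odd q" using that by (auto simp: odd_prime_power_def intro: odd_pos)
    then show "odd_finite_field (F q)"
      using F[OF that] card_ge_0_finite[of "carrier (F q)"]
      by (simp add: odd_finite_field_def odd_finite_field_axioms_def)
    then show "odd_finite_field.q (F q) = q"
      using F[OF that] by (simp add: odd_finite_field.q_def)
  qed
  {
    fix q n :: nat assume "odd_prime_power q" "[q = 3] (mod 4)" "[n = 2] (mod 4)"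
    then show "Omega (F q) n = {}"
      using odd_finite_field.Omega_eq_empty[OF loc, of q n] card by (simp add: cong_def)
  next
    fix q n :: nat assume "odd_prime_power q" "[q = 3] (mod 4)" "[n = 1] (mod 4)"
    then show "Omega_tilde (F q) (n + 1) = {}"
      using odd_finite_field.Omega_tilde_eq_empty[OF loc, of q n] card by (simp add: cong_def)
  next
    fix n :: "nat \<Rightarrow> nat"
    assume lim: "filterlim n at_top (q_at_top (\<lambda>q. [q = 3] (mod 4)))"
      "((\<lambda>q. real (n q) / real q powr (1 / 4)) \<longlongrightarrow> 0) (q_at_top (\<lambda>q. [q = 3] (mod 4)))"
    show "(\<lambda>q. real (card (Omega (F q) (n q))))
          \<sim>[q_at_top (\<lambda>q. [q = 3] (mod 4) \<and> [n q = 0] (mod 4))]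
          (\<lambda>q. 2 powr (2 - real (n q)) * real (q choose n q))"
    \<comment> \<open>The limits are assumed along all q in the residue class; the congruence on
      \<open>n q\<close> only makes the filter smaller, so they persist.\<close>
    proof (rule asymp_equiv_q_at_topI[where h = "\<lambda>x. 2 powr (2 - x)"])
      fix q assume "odd_prime_power q" "[q = 3] (mod 4) \<and> [n q = 0] (mod 4)" "n q \<ge> 1" "4 * n q ^ 4 \<le> q"
      moreover from this have "even (n q)" unfolding cong_def by presburger
      ultimately show "\<bar>real (card (Omega (F q) (n q))) - 2 powr (2 - real (n q)) * real (q choose n q)\<bar> \<le>
        28 * (real (n q) ^ 4 / real q) * (2 powr (2 - real (n q)) * real (q choose n q))"
        using odd_finite_field.card_Omega_rel_error[OF loc[of q], of "n q"] card[of q] by (simp add: cong_def)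
    qed (auto intro!: filterlim_mono[OF lim(1)] tendsto_mono[OF _ lim(2)] q_at_top_mono)
    show "(\<lambda>q. real (card (Omega_tilde (F q) (n q + 1))))
          \<sim>[q_at_top (\<lambda>q. [q = 3] (mod 4) \<and> [n q = 3] (mod 4))]
          (\<lambda>q. 2 powr (1 - real (n q)) * real (q choose n q))"
    proof (rule asymp_equiv_q_at_topI[where h = "\<lambda>x. 2 powr (1 - x)"])
      fix q assume "odd_prime_power q" "[q = 3] (mod 4) \<and> [n q = 3] (mod 4)" "n q \<ge> 1" "4 * n q ^ 4 \<le> q"
      moreover from this have "odd (n q)" unfolding cong_def by presburger
      ultimately show "\<bar>real (card (Omega_tilde (F q) (n q + 1))) - 2 powr (1 - real (n q)) * real (q choose n q)\<bar> \<le>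
        28 * (real (n q) ^ 4 / real q) * (2 powr (1 - real (n q)) * real (q choose n q))"
        using odd_finite_field.card_Omega_tilde_rel_error[OF loc[of q], of "n q"] card[of q] by (simp add: cong_def)
    qed (auto intro!: filterlim_mono[OF lim(1)] tendsto_mono[OF _ lim(2)] q_at_top_mono)
  next
    fix n :: "nat \<Rightarrow> nat"
    assume lim: "filterlim n at_top (q_at_top (\<lambda>q. [q = 1] (mod 4)))"
      "((\<lambda>q. real (n q) / real q powr (1 / 4)) \<longlongrightarrow> 0) (q_at_top (\<lambda>q. [q = 1] (mod 4)))"
    show "(\<lambda>q. real (card (Omega (F q) (n q))))
          \<sim>[q_at_top (\<lambda>q. [q = 1] (mod 4) \<and> even (n q))]
          (\<lambda>q. 2 powr (2 - real (n q)) * real (q choose n q))"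
    proof (rule asymp_equiv_q_at_topI[where h = "\<lambda>x. 2 powr (2 - x)"])
      fix q assume "odd_prime_power q" "[q = 1] (mod 4) \<and> even (n q)" "n q \<ge> 1" "4 * n q ^ 4 \<le> q"
      then show "\<bar>real (card (Omega (F q) (n q))) - 2 powr (2 - real (n q)) * real (q choose n q)\<bar> \<le>
        28 * (real (n q) ^ 4 / real q) * (2 powr (2 - real (n q)) * real (q choose n q))"
        using odd_finite_field.card_Omega_rel_error[OF loc[of q], of "n q"] card[of q] by (simp add: cong_def)
    qed (auto intro!: filterlim_mono[OF lim(1)] tendsto_mono[OF _ lim(2)] q_at_top_mono)
    show "(\<lambda>q. real (card (Omega_tilde (F q) (n q + 1))))
          \<sim>[q_at_top (\<lambda>q. [q = 1] (mod 4) \<and> odd (n q))]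
          (\<lambda>q. 2 powr (1 - real (n q)) * real (q choose n q))"
    proof (rule asymp_equiv_q_at_topI[where h = "\<lambda>x. 2 powr (1 - x)"])
      fix q assume "odd_prime_power q" "[q = 1] (mod 4) \<and> odd (n q)" "n q \<ge> 1" "4 * n q ^ 4 \<le> q"
      then show "\<bar>real (card (Omega_tilde (F q) (n q + 1))) - 2 powr (1 - real (n q)) * real (q choose n q)\<bar> \<le>
        28 * (real (n q) ^ 4 / real q) * (2 powr (1 - real (n q)) * real (q choose n q))"
        using odd_finite_field.card_Omega_tilde_rel_error[OF loc[of q], of "n q"] card[of q] by (simp add: cong_def)
    qed (auto intro!: filterlim_mono[OF lim(1)] tendsto_mono[OF _ lim(2)] q_at_top_mono)
  }
qed

end
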